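(* Let $p$ be irreducible and aperiodic with unique invariant probability measure $m$, let $q$ be the committor and $q^-$ the backward committor, and consider the equilibrium nonreactive and reactive path ensembles built from an infinitely long stationary trajectory $x_0,x_1,\dots$ with $x_0\sim m$. Then: 1. $$Z:=\sum_{x\in A}\sum_{y\in V}m(y)(1-q^-(y))p(x\,|\,y)=\sum_{x\in B}\sum_{y\in V}m(y)q^-(y)p(x\,|\,y).$$ 2. The initial distribution $\mu$ (on $A$) of the ensemble of nonreactive segments is $$\mu(x)=\frac1Z\sum_{y\in V}m(y)\big(1-q^-(y)\big)p(x\,|\,y),\qquad x\in A.$$ 3. With this $\mu$, the average number of visits $\theta(x)=\langle\sum_{l=0}^{\tau_B}\mathbf 1_x(x_l)\rangle$ of first passage paths satisfies $$\theta(x)=\begin{cases}\frac1Z m(x)q^-(x), & x\in B^c,\\ \frac1Z\sum_{y\in V}m(y)q^-(y)p(x\,|\,y), & x\in B.\end{cases}$$ 4. The initial distribution $\mu_r$ of the ensemble of reactive segments, and $\bar\theta(x)=\langle\sum_{l=0}^{\sigma}\mathbf 1_x(x_l)\rangle$, $\widetilde\theta(x)=\langle\sum_{l=\sigma}^{\tau_B}\mathbf 1_x(x_l)\rangle$ satisfy $$\mu_r(x)=\frac1Z m(x)\Big[\sum_{z\in V}p(z\,|\,x)q(z)\Big],\quad \forall x\in A,$$ $$\bar\theta(x)=\frac1Z m(x)q^-(x)(1-q(x)),\quad\forall x\in V,$$ $$\widetilde\theta(x)=\begin{cases}\frac1Z m(x)q^-(x)q(x)+\frac1Z m(x)\Big[\sum_{z\in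 V}p(z\,|\,x)q(z)\Big]\mathbf 1_A(x), & x\in B^c,\\ \frac1Z\sum_{y\in V}m(y)q^-(y)p(x\,|\,y), & x\in B.\end{cases}$$
   Context: $V=\{1,\dots,n\}$ with $n>1$; $p(y\,|\,x)$, $x,y\in V$, is the probability that a discrete-time Markov chain on $V$ jumps from $x$ to $y$. $A,B\subset V$ are disjoint and nonempty with $(A\cup B)^c\neq\emptyset$ (complements in $V$). Committor: $q(x)=\mathbb P(\tau_{B,x}<\tau_{A,x})$, where $\tau_{A,x},\tau_{B,x}$ are the first hitting times (over $k\ge0$) of $A,B$ by the chain started at $x$. Time-reversed chain: $p^-(y\,|\,x)=\frac{m(y)p(x\,|\,y)}{m(x)}$. Backward committor $q^-$: the solution of $\sum_{y\in V}p^-(y\,|\,x)q^-(y)=q^-(x)$ for $x\in(A\cup B)^c$, $q^-|_A=1$, $q^-|_B=0$. Equilibrium ensembles: for the stationary trajectory $(x_l)_{l\ge0}$ set $\tau_A^{(0)}=\tau_B^{(0)}=0$ and, for $k\ge0$, $\tau_A^{(k+1)}=\min\{l\ge\tau_B^{(k)}:x_l\in A\}$, $\tau_B^{(k+1)}=\min\{l\ge\tau_A^{(k+1)}:x_l\in B\}$; for $k\ge1$, $\sigma^{(k)}=\max\{l: x_l\in A,\ \tau_A^{(k)}\le l<\tau_B^{(k)}\}$. The nonreactive segments are $(x_{\tau_A^{(k)}},\dots,x_{\sigma^{(k)}})$ and the reactive segments are $(x_{\sigma^{(k)}},\dots,x_{\tau_B^{(k)}})$, $k\ge1$. The initial distributions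 $\mu$ and $\mu_r$ of these ensembles are the almost sure limiting frequencies $\mu(x)=\lim_{K\to\infty}\frac1K\sum_{k=1}^K\mathbf 1_x(x_{\tau_A^{(k)}})$ and $\mu_r(x)=\lim_{K\to\infty}\frac1K\sum_{k=1}^K\mathbf 1_x(x_{\sigma^{(k)}})$, $x\in A$. In $\theta,\bar\theta,\widetilde\theta$, $\langle\cdot\rangle$ denotes expectation for the chain with transition probabilities $p$ started from $x_0\sim\mu$ (this $\mu$), with $\tau_B=\min\{k\ge0:x_k\in B\}$ and $\sigma=\max\{l:x_l\in A,\ 0\le l<\tau_B\}$. *)

theory Defs
  imports "HOL-Probability.Probability"
begin

section \<open>Finite Markov chains\<close>

text \<open>
  Throughout, a transition matrix \<open>p\<close> is written in the order of the conditional
  probability: \<open>p y x\<close> stands for $p(y\,|\,x)$, the probability of a jump from \<open>x\<close> to \<open>y\<close>.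
\<close>

definition prob_vector :: "'a set \<Rightarrow> ('a \<Rightarrow> real) \<Rightarrow> bool" where
  "prob_vector V f \<longleftrightarrow> (\<forall>x\<in>V. 0 \<le> f x) \<and> (\<Sum>x\<in>V. f x) = 1"

definition transition_matrix :: "'a set \<Rightarrow> ('a \<Rightarrow> 'a \<Rightarrow> real) \<Rightarrow> bool" where
  "transition_matrix V p \<longleftrightarrow> (\<forall>x\<in>V. prob_vector V (\<lambda>y. p y x))"

primrec kstep :: "'a set \<Rightarrow> ('a \<Rightarrow> 'a \<Rightarrow> real) \<Rightarrow> nat \<Rightarrow> 'a \<Rightarrow> 'a \<Rightarrow> real" where
  "kstep V p 0 y x = of_bool (y = x)"
| "kstep V p (Suc k) y x = (\<Sum>z\<in>V. p y z * kstep V p k z x)"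

definition irreducible_chain :: "'a set \<Rightarrow> ('a \<Rightarrow> 'a \<Rightarrow> real) \<Rightarrow> bool" where
  "irreducible_chain V p \<longleftrightarrow> (\<forall>x\<in>V. \<forall>y\<in>V. \<exists>k. 0 < kstep V p k y x)"

definition aperiodic_chain :: "'a set \<Rightarrow> ('a \<Rightarrow> 'a \<Rightarrow> real) \<Rightarrow> bool" where
  "aperiodic_chain V p \<longleftrightarrow> (\<forall>x\<in>V. Gcd {k. 1 \<le> k \<and> 0 < kstep V p k x x} = 1)"

definition invariant_measure :: "'a set \<Rightarrow> ('a \<Rightarrow> 'a \<Rightarrow> real) \<Rightarrow> ('a \<Rightarrow> real) \<Rightarrow> bool" where
  "invariant_measure V p m \<longleftrightarrow>
     prob_vector V m \<and> (\<forall>x\<in>V. (\<Sum>y\<in>V. m y * p x y) = m x)"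


subsection \<open>The law of the chain on trajectories\<close>

definition chain_kernel ::
  "'a set \<Rightarrow> ('a \<Rightarrow> 'a \<Rightarrow> real) \<Rightarrow> ('a \<Rightarrow> real) \<Rightarrow> nat \<Rightarrow> (nat \<Rightarrow> 'a) \<Rightarrow> 'a measure" where
  "chain_kernel V p init i \<omega> =
     point_measure V (\<lambda>y. ennreal (if i = 0 then init y else p y (\<omega> (i - 1))))"

text \<open>
  The measure on \<open>nat \<Rightarrow> V\<close> with initial distribution \<open>init\<close> and transition probabilities \<open>p\<close>,
  obtained from the Ionescu-Tulcea theorem; the lemma \<open>emeasure_chain_cylinder\<close> below
  computes its finite-dimensional distributions.
\<close>

definition chain :: "'a set \<Rightarrow> ('a \<Rightarrow> 'a \<Rightarrow> real) \<Rightarrow> ('a \<Rightarrow> real) \<Rightarrow> (nat \<Rightarrow> 'a) measure" where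
  "chain V p init =
     projective_family.lim UNIV
       (Ionescu_Tulcea.CI (chain_kernel V p init) (\<lambda>_. count_space V)) (\<lambda>_. count_space V)"

lemma Ionescu_Tulcea_chain:
  assumes V: "finite V" and p: "transition_matrix V p" and i: "prob_vector V init"
  shows "Ionescu_Tulcea (chain_kernel V p init) (\<lambda>_. count_space V)"
proof (rule Ionescu_Tulcea.intro)
  have ps: "prob_space (chain_kernel V p init i x)"
    if "x \<in> space (PiM {0..<i} (\<lambda>_. count_space V))" for i x
    using that p i V unfolding chain_kernel_def transition_matrix_def prob_vector_def
    by (cases "i = 0"; intro prob_space_point_measure) (auto simp: space_PiM PiE_iff sum_ennreal)
  show "prob_space (chain_kernel V p init i x)"
    if "x \<in> space (PiM {0..<i} (\<lambda>_. count_space V))" for i x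
    using that by (rule ps)
  show "chain_kernel V p init i \<in> measurable (PiM {0..<i} (\<lambda>_. count_space V)) (subprob_algebra (count_space V))" for i
  proof (rule measurable_subprob_algebra)
    fix a assume a: "a \<in> space (PiM {0..<i} (\<lambda>_. count_space V))"
    show "subprob_space (chain_kernel V p init i a)"
      using ps[OF a] by (rule prob_space_imp_subprob_space)
    show "sets (chain_kernel V p init i a) = sets (count_space V)"
      by (simp add: chain_kernel_def sets_point_measure)
  next
    fix S assume "S \<in> sets (count_space V)"
    then have S: "S \<subseteq> V" by simp
    have "(\<lambda>\<omega>. \<Sum>y\<in>S. ennreal (if i = 0 then init y else p y (\<omega> (i - 1))))
        \<in> borel_measurable (PiM {0..<i} (\<lambda>_. count_space V))"
    proof (cases "i = 0")
      case False
      then have "i - 1 \<in> {0..<i}" by auto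
      from measurable_component_singleton[OF this, of "\<lambda>_. count_space V"]
      have m: "(\<lambda>\<omega>. \<omega> (i - 1)) \<in> measurable (PiM {0..<i} (\<lambda>_. count_space V)) (count_space V)" .
      have "(\<lambda>\<omega>. ennreal (p y (\<omega> (i - 1)))) \<in> borel_measurable (PiM {0..<i} (\<lambda>_. count_space V))" for y
        by (rule measurable_compose[OF m]) simp
      then show ?thesis
        using False by simp
    qed simp
    then show "(\<lambda>a. emeasure (chain_kernel V p init i a) S) \<in> borel_measurable (PiM {0..<i} (\<lambda>_. count_space V))"
      using S V by (simp add: chain_kernel_def emeasure_point_measure_finite)
  qed
qed

lemma sets_chain:
  assumes "finite V" "transition_matrix V p" "prob_vector V init"
  shows "sets (chain V p init) = sets (PiM UNIV (\<lambda>_. count_space V))"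
proof -
  interpret Ionescu_Tulcea "chain_kernel V p init" "\<lambda>_. count_space V"
    using assms by (rule Ionescu_Tulcea_chain)
  show ?thesis unfolding chain_def by simp
qed

lemma prob_space_chain:
  assumes "finite V" "transition_matrix V p" "prob_vector V init"
  shows "prob_space (chain V p init)"
proof -
  interpret Ionescu_Tulcea "chain_kernel V p init" "\<lambda>_. count_space V"
    using assms by (rule Ionescu_Tulcea_chain)
  interpret C: prob_space "CI {}"
    by (rule PF.prob_space_P) auto
  have "emeasure PF.lim (PF.emb UNIV {} (space (PiM {} (\<lambda>_. count_space V)))) = 1"
    using C.emeasure_space_1 by (subst lim) (auto simp: PF.space_P)
  then show ?thesis
    unfolding chain_def by (intro prob_spaceI) (simp add: prod_emb_def space_PiM restrict_def)
qed

lemma emeasure_chain_cylinder: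
  assumes V: "finite V" and p: "transition_matrix V p" and init: "prob_vector V init"
    and xs: "\<And>i. i \<le> k \<Longrightarrow> xs i \<in> V"
  shows "emeasure (chain V p init) {\<omega> \<in> space (chain V p init). \<forall>i\<le>k. \<omega> i = xs i} =
    ennreal (init (xs 0) * (\<Prod>i<k. p (xs (Suc i)) (xs i)))"
proof -
  interpret Ionescu_Tulcea "chain_kernel V p init" "\<lambda>_. count_space V"
    using assms by (intro Ionescu_Tulcea_chain)
  let ?M = "\<lambda>_::nat. count_space V"
  let ?S = "\<lambda>n. {restrict xs {0..<n}}"
  have sing: "?S n \<in> sets (PiM {0..<n} ?M)" if "\<And>i. i < n \<Longrightarrow> xs i \<in> V" for n
  proof -
    have "PiE {0..<n} (\<lambda>i. {xs i}) \<in> sets (PiM {0..<n} ?M)"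
      using that by (intro sets_PiM_I_finite) auto
    also have "PiE {0..<n} (\<lambda>i. {xs i}) = ?S n"
      by (auto simp: PiE_iff extensional_def restrict_def fun_eq_iff)
    finally show ?thesis .
  qed
  have 0: "restrict xs {0..<n} \<in> space (PiM {0..<n} ?M)" if "\<And>i. i < n \<Longrightarrow> xs i \<in> V" for n
    using sing[OF that] sets.sets_into_space by blast
  have kern: "emeasure (chain_kernel V p init n \<omega>) {y}
      = ennreal (if n = 0 then init y else p y (\<omega> (n - 1)))" if "y \<in> V" for n \<omega> y
    using that V by (simp add: chain_kernel_def emeasure_point_measure_finite)
  have un: "(\<lambda>_. undefined) \<in> space (PiM {0..<0} ?M)"
    by (simp add: space_PiM)
  have C: "emeasure (C 0 (Suc n) (\<lambda>_. undefined)) (?S (Suc n)) =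
      ennreal (init (xs 0) * (\<Prod>i<n. p (xs (Suc i)) (xs i)))"
    if "\<And>i. i \<le> n \<Longrightarrow> xs i \<in> V" for n
    using that
  proof (induction n)
    have step: "emeasure (C 0 (Suc n) (\<lambda>_. undefined)) (?S (Suc n)) =
        ennreal (if n = 0 then init (xs n) else p (xs n) (xs (n - 1))) *
        emeasure (C 0 n (\<lambda>_. undefined)) (?S n)" if *: "\<And>i. i \<le> n \<Longrightarrow> xs i \<in> V" for n
    proof -
      have S: "?S (Suc n) \<in> sets (PiM {0..<Suc n} ?M)" "?S n \<in> sets (PiM {0..<n} ?M)"
        using * by (intro sing; simp)+
      have e: "emeasure (eP n \<omega>) (?S (Suc n)) =
        ennreal (if n = 0 then init (xs n) else p (xs n) (xs (n - 1))) * indicator (?S n) \<omega>"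
        if \<omega>: "\<omega> \<in> space (PiM {0..<n} ?M)" for \<omega>
      proof -
        have ext: "\<omega> j = undefined" if "j \<ge> n" for j
          using \<omega> that by (auto simp: space_PiM PiE_iff extensional_def)
        have "(\<lambda>x. fun_upd \<omega> n x) -` ?S (Suc n) \<inter> V =
           (if \<omega> = restrict xs {0..<n} then {xs n} else {})" (is "?L = ?R")
        proof (cases "\<omega> = restrict xs {0..<n}")
          case True
          then have "(fun_upd \<omega> n x = restrict xs {0..<Suc n}) = (x = xs n)" for x
            by (auto simp: fun_eq_iff restrict_def less_Suc_eq dest: spec[of _ n])
          then show ?thesis using True *[of n] by auto
        next
          case False
          then obtain j where j: "\<omega> j \<noteq> restrict xs {0..<n} j" by (auto simp: fun_eq_iff)
          then have "j < n" using ext[of j] by (cases "j < n") auto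
          then have "(fun_upd \<omega> n x) j \<noteq> restrict xs {0..<Suc n} j" for x
            using j by auto
          then have "fun_upd \<omega> n x \<noteq> restrict xs {0..<Suc n}" for x by metis
          then show ?thesis using False by auto
        qed
        then show ?thesis
          using S *[of n] kern[of "xs n" n \<omega>] by (subst emeasure_eP[OF \<omega>]) (auto simp: indicator_def)
      qed
      have "emeasure (C 0 (Suc n) (\<lambda>_. undefined)) (?S (Suc n)) =
         (\<integral>\<^sup>+\<omega>. emeasure (eP n \<omega>) (?S (Suc n)) \<partial>C 0 n (\<lambda>_. undefined))"
        using S prob_space_C[OF un, of n, THEN prob_space.not_empty]
        by (simp only: C.simps)
           (subst emeasure_bind[where N="PiM {0..<Suc n} ?M"];
             simp add: measurable_cong_sets[OF sets_C[OF un] refl] del: sets_PiM_cong)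
      also have "\<dots> = (\<integral>\<^sup>+\<omega>. ennreal (if n = 0 then init (xs n) else p (xs n) (xs (n - 1))) * indicator (?S n) \<omega> \<partial>C 0 n (\<lambda>_. undefined))"
        using e by (intro nn_integral_cong) (simp add: space_C[OF un])
      also have "\<dots> = ennreal (if n = 0 then init (xs n) else p (xs n) (xs (n - 1))) *
          emeasure (C 0 n (\<lambda>_. undefined)) (?S n)"
        using S by (intro nn_integral_cmult_indicator) (simp add: sets_C[OF un])
      finally show ?thesis .
    qed
    {
      case 0
      have "emeasure (C 0 0 (\<lambda>_. undefined)) (?S 0) = 1"
        using sing[of 0] by (simp add: restrict_def emeasure_return)
      then show ?case using step[of 0] 0 by (simp del: C.simps add: restrict_def)
    next
      case (Suc n)
      have "0 \<le> p (xs (Suc n)) (xs n)"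
        using Suc.prems[of n] Suc.prems[of "Suc n"] p by (auto simp: transition_matrix_def prob_vector_def)
      moreover have "(\<Prod>i<Suc n. p (xs (Suc i)) (xs i)) =
          p (xs (Suc n)) (xs n) * (\<Prod>i<n. p (xs (Suc i)) (xs i))"
        by simp
      moreover have "emeasure (C 0 (Suc n) (\<lambda>_. undefined)) (?S (Suc n)) =
          ennreal (init (xs 0) * (\<Prod>i<n. p (xs (Suc i)) (xs i)))"
        by (rule Suc.IH) (use Suc.prems in auto)
      moreover have "emeasure (C 0 (Suc (Suc n)) (\<lambda>_. undefined)) (?S (Suc (Suc n))) =
          ennreal (p (xs (Suc n)) (xs n)) * emeasure (C 0 (Suc n) (\<lambda>_. undefined)) (?S (Suc n))"
        using step[of "Suc n"] Suc.prems by (simp only: nat.simps if_False diff_Suc_1)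
      ultimately show ?case
        by (simp only: ennreal_mult'[symmetric] mult.left_commute)
    }
  qed
  have X: "?S (Suc k) \<in> sets (PiM {0..<Suc k} ?M)"
    using xs by (intro sing) simp
  have "{\<omega> \<in> space (chain V p init). \<forall>i\<le>k. \<omega> i = xs i} = PF.emb UNIV {0..<Suc k} (?S (Suc k))"
    by (auto simp: chain_def prod_emb_def space_PiM fun_eq_iff restrict_def less_Suc_eq_le
          split: if_splits)
  then have "emeasure (chain V p init) {\<omega> \<in> space (chain V p init). \<forall>i\<le>k. \<omega> i = xs i}
      = emeasure (CI {0..<Suc k}) (?S (Suc k))"
    using X by (simp add: chain_def lim)
  also have "\<dots> = emeasure (C 0 (Suc k) (\<lambda>_. undefined)) (PF.emb {0..<Suc k} {0..<Suc k} (?S (Suc k)))"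
    using X by (intro emeasure_CI) auto
  also have "PF.emb {0..<Suc k} {0..<Suc k} (?S (Suc k)) = ?S (Suc k)"
    using sets.sets_into_space[OF X] by (intro prod_emb_id) (auto simp: space_PiM)
  finally show ?thesis
    using C[of k] xs by simp
qed


section \<open>Committors\<close>

definition hitting_time :: "'a set \<Rightarrow> (nat \<Rightarrow> 'a) \<Rightarrow> enat" where
  "hitting_time S \<omega> = Inf (enat ` {k. \<omega> k \<in> S})"

definition committor ::
  "'a set \<Rightarrow> ('a \<Rightarrow> 'a \<Rightarrow> real) \<Rightarrow> 'a set \<Rightarrow> 'a set \<Rightarrow> 'a \<Rightarrow> real" where
  "committor V p A B x =
     (let P = chain V p (indicator {x})
      in measure P {\<omega> \<in> space P. hitting_time B \<omega> < hitting_time A \<omega>})"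

definition reversed :: "('a \<Rightarrow> 'a \<Rightarrow> real) \<Rightarrow> ('a \<Rightarrow> real) \<Rightarrow> 'a \<Rightarrow> 'a \<Rightarrow> real" where
  "reversed p m y x = m y * p x y / m x"

definition backward_committor ::
  "'a set \<Rightarrow> ('a \<Rightarrow> 'a \<Rightarrow> real) \<Rightarrow> ('a \<Rightarrow> real) \<Rightarrow> 'a set \<Rightarrow> 'a set \<Rightarrow> ('a \<Rightarrow> real) \<Rightarrow> bool" where
  "backward_committor V p m A B qm \<longleftrightarrow>
     (\<forall>x\<in>V - (A \<union> B). (\<Sum>y\<in>V. reversed p m y x * qm y) = qm x) \<and>
     (\<forall>x\<in>A. qm x = 1) \<and> (\<forall>x\<in>B. qm x = 0)"


section \<open>Nonreactive and reactive segments of a trajectory\<close>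

fun entry_A entry_B :: "'a set \<Rightarrow> 'a set \<Rightarrow> (nat \<Rightarrow> 'a) \<Rightarrow> nat \<Rightarrow> nat" where
  "entry_A A B \<omega> 0 = 0"
| "entry_A A B \<omega> (Suc k) = (LEAST l. entry_B A B \<omega> k \<le> l \<and> \<omega> l \<in> A)"
| "entry_B A B \<omega> 0 = 0"
| "entry_B A B \<omega> (Suc k) = (LEAST l. entry_A A B \<omega> (Suc k) \<le> l \<and> \<omega> l \<in> B)"

definition exit_A :: "'a set \<Rightarrow> 'a set \<Rightarrow> (nat \<Rightarrow> 'a) \<Rightarrow> nat \<Rightarrow> nat" where
  "exit_A A B \<omega> k = Max {l. \<omega> l \<in> A \<and> entry_A A B \<omega> k \<le> l \<and> l < entry_B A B \<omega> k}"

text \<open>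
  The initial distributions are defined as the almost sure limiting frequencies along the
  trajectory with initial distribution \<open>m\<close>. The first two conjuncts say that \<open>A\<close> and \<open>B\<close> are
  visited infinitely often, so that all \<open>entry_A\<close>, \<open>entry_B\<close>, \<open>exit_A\<close> are genuine minima
  and maxima. For \<open>x \<notin> A\<close> all frequencies vanish, so \<open>\<mu> x = 0\<close> is forced.
\<close>

definition initial_distribution ::
  "('a set \<Rightarrow> 'a set \<Rightarrow> (nat \<Rightarrow> 'a) \<Rightarrow> nat \<Rightarrow> nat) \<Rightarrow>
   'a set \<Rightarrow> ('a \<Rightarrow> 'a \<Rightarrow> real) \<Rightarrow> ('a \<Rightarrow> real) \<Rightarrow> 'a set \<Rightarrow> 'a set \<Rightarrow> ('a \<Rightarrow> real) \<Rightarrow> bool" where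
  "initial_distribution start V p m A B \<mu> \<longleftrightarrow>
     (AE \<omega> in chain V p m.
        (\<exists>\<^sub>\<infinity>l. \<omega> l \<in> A) \<and> (\<exists>\<^sub>\<infinity>l. \<omega> l \<in> B) \<and>
        (\<forall>x. (\<lambda>K. (\<Sum>k=1..K. indicator {x} (\<omega> (start A B \<omega> k))) / real K) \<longlonglongrightarrow> \<mu> x))"

abbreviation "nonreactive_initial_distribution \<equiv> initial_distribution entry_A"
abbreviation "reactive_initial_distribution \<equiv> initial_distribution exit_A"


section \<open>Average numbers of visits of first passage paths\<close>

text \<open>
  If \<open>A\<close> and \<open>B\<close> are disjoint and the trajectory starts in \<open>A\<close> and hits \<open>B\<close>, then the set
  below is nonempty and finite, and the supremum is its maximum.
\<close>

definition last_exit :: "'a set \<Rightarrow> 'a set \<Rightarrow> (nat \<Rightarrow> 'a) \<Rightarrow> enat" where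
  "last_exit A B \<omega> = Sup (enat ` {l. \<omega> l \<in> A \<and> enat l < hitting_time B \<omega>})"

definition visits :: "(nat \<Rightarrow> 'a) \<Rightarrow> enat \<Rightarrow> enat \<Rightarrow> 'a \<Rightarrow> ennreal" where
  "visits \<omega> s t x = (\<Sum>l. if s \<le> enat l \<and> enat l \<le> t \<and> \<omega> l = x then 1 else 0)"

text \<open>
  Expectations of visit numbers are extended-real valued, so that an equation with a real
  number includes finiteness.
\<close>

definition mean_visits ::
  "(nat \<Rightarrow> 'a) measure \<Rightarrow> ((nat \<Rightarrow> 'a) \<Rightarrow> enat) \<Rightarrow> ((nat \<Rightarrow> 'a) \<Rightarrow> enat) \<Rightarrow> 'a \<Rightarrow> ereal" where
  "mean_visits P s t x = enn2ereal (\<integral>\<^sup>+\<omega>. visits \<omega> (s \<omega>) (t \<omega>) x \<partial>P)"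

definition theta ::
  "'a set \<Rightarrow> ('a \<Rightarrow> 'a \<Rightarrow> real) \<Rightarrow> ('a \<Rightarrow> real) \<Rightarrow> 'a set \<Rightarrow> 'a set \<Rightarrow> 'a \<Rightarrow> ereal" where
  "theta V p \<mu> A B = mean_visits (chain V p \<mu>) (\<lambda>_. 0) (hitting_time B)"

definition theta_bar ::
  "'a set \<Rightarrow> ('a \<Rightarrow> 'a \<Rightarrow> real) \<Rightarrow> ('a \<Rightarrow> real) \<Rightarrow> 'a set \<Rightarrow> 'a set \<Rightarrow> 'a \<Rightarrow> ereal" where
  "theta_bar V p \<mu> A B = mean_visits (chain V p \<mu>) (\<lambda>_. 0) (last_exit A B)"

definition theta_tilde ::
  "'a set \<Rightarrow> ('a \<Rightarrow> 'a \<Rightarrow> real) \<Rightarrow> ('a \<Rightarrow> real) \<Rightarrow> 'a set \<Rightarrow> 'a set \<Rightarrow> 'a \<Rightarrow> ereal" where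
  "theta_tilde V p \<mu> A B = mean_visits (chain V p \<mu>) (last_exit A B) (hitting_time B)"

end

theory Submission
  imports Defs "HOL-Library.Discrete_Functions"
begin

text \<open>
  Attach to each time the last state of \<open>A \<union> B\<close> visited before it. Nonreactive segments start where
  \<open>A\<close> is entered and this last state lies in \<open>B\<close>; reactive segments start at the last state when
  \<open>B\<close> is entered and this state lies in \<open>A\<close>. So both frequencies are read off the
  empirical measure of the pair (current state, last state), without looking into the future.
  A strong law for martingale differences shows that every limit point of this empirical measure
  solves a Dirichlet problem, whose solution is unique by irreducibility; its marginals are
  \<open>m qm\<close> and \<open>m (1 - qm)\<close>.

  For the visit numbers, the occupation measures of the chain started from \<open>\<mu>\<close> and killed in \<open>B\<close>
  sum to a solution of the Dirichlet problem that is also solved by \<open>m qm / Z\<close>. By the Markov property,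
  the parts before and after the last exit from \<open>A\<close> carry the factors \<open>1 - q\<close> and \<open>\<Sum>z. p z x q z\<close>.
\<close>

section \<open>First-step analysis and the Markov property\<close>

text \<open>The cycles between successive entrances to A are governed by a chain of entrance states
  whose ergodicity would need its own proof, and the last exit is not a stopping time. Counting per
  unit of time removes both difficulties: the cycles enter only through their number, which grows at
  rate \<open>Z\<close>, the flux into A of the mass whose last state lies in B. The pair of current
  and last state need not be irreducible on its product space, so no ergodic theorem is applied to
  it; compactness supplies limit points, and the Dirichlet problem needs only uniqueness. Existence
  then comes for free, from the limit along one path.

  The backward committor is given by linear equations alone. That \<open>m qm\<close> and
  \<open>m (1 - qm)\<close> are nonnegative follows because they are limits of counts; this is what
  makes \<open>Z\<close> positive and \<open>\<mu>\<close> a probability vector. The visit formulas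
  ask at each fixed time l whether l lies before or after the last exit, an event of the path
  shifted by l, so the Markov property at deterministic times suffices.\<close>

definition path_shift :: "nat \<Rightarrow> (nat \<Rightarrow> 'a) \<Rightarrow> nat \<Rightarrow> 'a" where
  "path_shift l \<omega> = (\<lambda>i. \<omega> (l + i))"

locale finite_chain =
  fixes V :: "'a set" and p :: "'a \<Rightarrow> 'a \<Rightarrow> real"
  assumes finite_V: "finite V" and transition: "transition_matrix V p"
begin

abbreviation paths :: "(nat \<Rightarrow> 'a) measure" where
  "paths \<equiv> PiM UNIV (\<lambda>_. count_space V)"

abbreviation chain_from :: "'a \<Rightarrow> (nat \<Rightarrow> 'a) measure" where
  "chain_from x \<equiv> chain V p (indicator {x})"

lemma p_nonneg: "x \<in> V \<Longrightarrow> y \<in> V \<Longrightarrow> 0 \<le> p y x"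
  using transition by (auto simp: transition_matrix_def prob_vector_def)

lemma sum_p: "x \<in> V \<Longrightarrow> (\<Sum>y\<in>V. p y x) = 1"
  using transition by (auto simp: transition_matrix_def prob_vector_def)

lemma prob_vector_p: "x \<in> V \<Longrightarrow> prob_vector V (\<lambda>y. p y x)"
  using transition by (auto simp: transition_matrix_def)

lemma prob_vector_indicator: "x \<in> V \<Longrightarrow> prob_vector V (indicator {x})"
  using finite_V by (simp add: prob_vector_def indicator_def)

lemmas sets_chain_eq [simp, measurable_cong] = sets_chain[OF finite_V transition]
lemmas prob_space_chain_init = prob_space_chain[OF finite_V transition]

lemma space_paths: "space paths = {\<omega>. \<forall>i. \<omega> i \<in> V}"
  by (auto simp: space_PiM PiE_iff)

lemma space_chain [simp]: "prob_vector V init \<Longrightarrow> space (chain V p init) = {\<omega>. \<forall>i. \<omega> i \<in> V}"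
  using sets_eq_imp_space_eq[OF sets_chain_eq] by (simp add: space_paths)

lemma measurable_coord [measurable]: "(\<lambda>\<omega>. \<omega> i) \<in> paths \<rightarrow>\<^sub>M count_space UNIV"
  by (rule measurable_compose[OF measurable_component_singleton]) auto

lemma measurable_path_shift [measurable]: "path_shift l \<in> paths \<rightarrow>\<^sub>M paths"
  unfolding path_shift_def
  by (rule measurable_PiM_single') (auto simp: space_PiM PiE_iff)

lemma measurable_case_nat [measurable]: "x \<in> V \<Longrightarrow> case_nat x \<in> paths \<rightarrow>\<^sub>M paths"
proof (rule measurable_PiM_single')
  assume "x \<in> V"
  then show "(\<lambda>\<omega>. case_nat x \<omega> i) \<in> paths \<rightarrow>\<^sub>M count_space V" for i
    by (cases i) auto
qed (auto simp: space_PiM PiE_iff split: nat.splits)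

text \<open>Equality of measures on the path space is tested on finite-dimensional rectangles. Since
  V is finite, such a rectangle is a finite disjoint union of cylinders that fix all coordinates
  from 0 to k.\<close>

lemma chain_eqI:
  assumes init: "prob_vector V init" and M: "sets M = sets paths"
    and cyl: "\<And>k xs. (\<And>i. i \<le> k \<Longrightarrow> xs i \<in> V) \<Longrightarrow>
      emeasure M {\<omega> \<in> space paths. \<forall>i\<le>k. \<omega> i = xs i} =
      ennreal (init (xs 0) * (\<Prod>i<k. p (xs (Suc i)) (xs i)))"
  shows "chain V p init = M"
proof (rule measure_eqI_PiM_infinite[OF sets_chain_eq[OF init] M])
  interpret prob_space "chain V p init" by (rule prob_space_chain_init[OF init])
  show "finite_measure (chain V p init)" by unfold_locales
  fix S :: "nat \<Rightarrow> 'a set" and J :: "nat set"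
  assume J: "finite J" "\<And>i. i \<in> J \<Longrightarrow> S i \<in> sets (count_space V)"
  obtain k where k: "J \<subseteq> {..k}"
    using J(1) unfolding finite_nat_iff_bounded_le by auto
  define Y where "Y = PiE {..k} (\<lambda>i. if i \<in> J then S i else V)"
  define C where "C xs = {\<omega> \<in> space paths. \<forall>i\<le>k. \<omega> i = xs i}" for xs :: "nat \<Rightarrow> 'a"
  have fin: "finite Y"
    unfolding Y_def using J finite_V by (intro finite_PiE) (auto intro: finite_subset)
  have YV: "xs i \<in> V" if "xs \<in> Y" "i \<le> k" for xs i
    using that J(2)[of i] by (auto simp: Y_def PiE_iff split: if_splits)
  have eq: "prod_emb UNIV (\<lambda>_. count_space V) J (PiE J S) = (\<Union>xs\<in>Y. C xs)"
  proof (intro set_eqI iffI)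
    fix \<omega> assume *: "\<omega> \<in> prod_emb UNIV (\<lambda>_. count_space V) J (PiE J S)"
    then have "restrict \<omega> {..k} \<in> Y"
      by (auto simp: Y_def prod_emb_def space_PiM PiE_iff)
    moreover have "\<omega> \<in> C (restrict \<omega> {..k})"
      using * by (auto simp: C_def prod_emb_def space_PiM PiE_iff)
    ultimately show "\<omega> \<in> (\<Union>xs\<in>Y. C xs)" by blast
  next
    fix \<omega> assume "\<omega> \<in> (\<Union>xs\<in>Y. C xs)"
    then obtain xs where xs: "xs \<in> Y" "\<omega> \<in> C xs" by blast
    have "\<omega> i \<in> S i" if "i \<in> J" for i
    proof -
      have "i \<le> k" using that k by auto
      then show ?thesis using xs that by (force simp: C_def Y_def PiE_iff)
    qed
    then show "\<omega> \<in> prod_emb UNIV (\<lambda>_. count_space V) J (PiE J S)"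
      using xs(2) by (auto simp: C_def prod_emb_def space_PiM PiE_iff)
  qed
  have meas: "C xs \<in> sets paths" for xs
    unfolding C_def by measurable
  have disj: "disjoint_family_on C Y"
  proof (unfold disjoint_family_on_def, intro ballI impI)
    fix xs ys assume xy: "xs \<in> Y" "ys \<in> Y" "xs \<noteq> ys"
    then obtain i where "xs i \<noteq> ys i" by (auto simp: fun_eq_iff)
    moreover from this have "i \<le> k"
      using xy by (cases "i \<le> k") (auto simp: Y_def PiE_iff extensional_def)
    ultimately show "C xs \<inter> C ys = {}" by (auto simp: C_def)
  qed
  have sum: "emeasure N (\<Union>xs\<in>Y. C xs) = (\<Sum>xs\<in>Y. emeasure N (C xs))"
    if "sets N = sets paths" for N
    using that fin meas disj by (intro sum_emeasure[symmetric]) auto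
  have "emeasure (chain V p init) (C xs) = emeasure M (C xs)" if "xs \<in> Y" for xs
    using emeasure_chain_cylinder[OF finite_V transition init, of k xs] cyl[of k xs] YV[OF that] init
    by (simp add: C_def space_paths)
  then show "emeasure (chain V p init) (prod_emb UNIV (\<lambda>_. count_space V) J (PiE J S)) =
      emeasure M (prod_emb UNIV (\<lambda>_. count_space V) J (PiE J S))"
    unfolding eq by (simp add: sum M init)
qed

text \<open>Source of all first-step arguments. On cylinders, the first factor of the product
  becomes the initial weight of the path after time 0.\<close>

lemma chain_from_distr:
  assumes x: "x \<in> V"
  shows "chain_from x = distr (chain V p (\<lambda>y. p y x)) paths (case_nat x)"
proof (rule chain_eqI[OF prob_vector_indicator[OF x]])
  let ?P = "chain V p (\<lambda>y. p y x)"
  note px = prob_vector_p[OF x]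
  interpret prob_space ?P by (rule prob_space_chain_init[OF px])
  have m: "case_nat x \<in> ?P \<rightarrow>\<^sub>M paths"
    using measurable_case_nat[OF x] px by (simp cong: measurable_cong_sets)
  fix k and xs :: "nat \<Rightarrow> 'a" assume xs: "\<And>i. i \<le> k \<Longrightarrow> xs i \<in> V"
  have meas: "{\<omega> \<in> space paths. \<forall>i\<le>k. \<omega> i = xs i} \<in> sets paths"
    by measurable
  have "emeasure (distr ?P paths (case_nat x)) {\<omega> \<in> space paths. \<forall>i\<le>k. \<omega> i = xs i}
     = emeasure ?P {\<omega> \<in> space ?P. \<forall>i\<le>k. case_nat x \<omega> i = xs i}"
    using x px by (subst emeasure_distr[OF m meas])
      (auto intro!: arg_cong[where f="emeasure _"] simp: space_paths split: nat.splits)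
  also have "\<dots> = ennreal (indicator {x} (xs 0) * (\<Prod>i<k. p (xs (Suc i)) (xs i)))"
  proof (cases k)
    case 0
    then have "{\<omega> \<in> space ?P. \<forall>i\<le>k. case_nat x \<omega> i = xs i} = (if xs 0 = x then space ?P else {})"
      by auto
    then show ?thesis using 0 by (simp add: emeasure_space_1 del: space_chain)
  next
    case (Suc j)
    have "(\<forall>i\<le>k. case_nat x \<omega> i = xs i) \<longleftrightarrow> xs 0 = x \<and> (\<forall>i\<le>j. \<omega> i = xs (Suc i))" for \<omega>
      unfolding Suc less_Suc_eq_le[symmetric] All_less_Suc2 by auto
    then have "{\<omega> \<in> space ?P. \<forall>i\<le>k. case_nat x \<omega> i = xs i} =
      (if xs 0 = x then {\<omega> \<in> space ?P. \<forall>i\<le>j. \<omega> i = xs (Suc i)} else {})"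
      by auto
    then show ?thesis
      using emeasure_chain_cylinder[OF finite_V transition px, of j "\<lambda>i. xs (Suc i)"] xs
      by (simp add: Suc prod.lessThan_Suc_shift del: space_chain prod.lessThan_Suc)
  qed
  finally show "emeasure (distr ?P paths (case_nat x)) {\<omega> \<in> space paths. \<forall>i\<le>k. \<omega> i = xs i}
     = ennreal (indicator {x} (xs 0) * (\<Prod>i<k. p (xs (Suc i)) (xs i)))" .
qed simp

text \<open>Makes expectations linear in the initial distribution, so that the chains started from
  \<open>m\<close> and \<open>\<mu>\<close> reduce to chains started from a point.\<close>

lemma chain_eq_bind:
  assumes init: "prob_vector V init"
  shows "chain V p init = point_measure V (\<lambda>x. ennreal (init x)) \<bind> chain_from"
proof (rule chain_eqI[OF init])
  let ?K = "point_measure V (\<lambda>x. ennreal (init x))"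
  have ne: "V \<noteq> {}" using init by (auto simp: prob_vector_def)
  have K: "chain_from \<in> ?K \<rightarrow>\<^sub>M subprob_algebra paths"
    by (auto simp: measurable_point_measure_eq1 space_subprob_algebra prob_vector_indicator
        intro!: prob_space_imp_subprob_space prob_space_chain_init)
  show "sets (?K \<bind> chain_from) = sets paths"
    using ne by (intro sets_bind) (auto simp: space_point_measure prob_vector_indicator)
  fix k and xs :: "nat \<Rightarrow> 'a" assume xs: "\<And>i. i \<le> k \<Longrightarrow> xs i \<in> V"
  let ?C = "{\<omega> \<in> space paths. \<forall>i\<le>k. \<omega> i = xs i}"
  let ?w = "\<Prod>i<k. p (xs (Suc i)) (xs i)"
  have w: "0 \<le> ?w" using xs by (intro prod_nonneg) (auto intro!: p_nonneg)
  have "emeasure (?K \<bind> chain_from) ?C = (\<integral>\<^sup>+x. emeasure (chain_from x) ?C \<partial>?K)"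
    by (rule emeasure_bind[OF _ K]) (use ne in \<open>auto simp: space_point_measure\<close>)
  also have "\<dots> = (\<Sum>x\<in>V. ennreal (init x) * ennreal (indicator {x} (xs 0) * ?w))"
  proof -
    have "emeasure (chain_from x) ?C = ennreal (indicator {x} (xs 0) * ?w)" if "x \<in> V" for x
      using emeasure_chain_cylinder[OF finite_V transition prob_vector_indicator[OF that] xs] that
      by (simp add: space_paths prob_vector_indicator)
    then show ?thesis by (simp add: nn_integral_point_measure_finite finite_V)
  qed
  also have "\<dots> = (\<Sum>x\<in>V. if x = xs 0 then ennreal (init x * ?w) else 0)"
    using init w by (intro sum.cong refl) (auto simp: ennreal_mult' prob_vector_def)
  also have "\<dots> = ennreal (init (xs 0) * ?w)"
    using finite_V xs[of 0] by simp
  finally show "emeasure (?K \<bind> chain_from) ?C = ennreal (init (xs 0) * ?w)" .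
qed


text \<open>The test functions of the first-step and Markov identities: integrable under every chain
  law, closed under algebraic operations, shifts and prefixing. The bound is asked only on paths in
  V, so that every function of one coordinate qualifies.\<close>

definition observable :: "((nat \<Rightarrow> 'a) \<Rightarrow> real) \<Rightarrow> bool" where
  "observable f \<longleftrightarrow> f \<in> borel_measurable paths \<and> (\<exists>c. \<forall>\<omega>\<in>space paths. \<bar>f \<omega>\<bar> \<le> c)"

lemma observable_measurable: "observable f \<Longrightarrow> f \<in> borel_measurable paths"
  by (simp add: observable_def)

lemma observable_const [simp]: "observable (\<lambda>_. c)"
  by (auto simp: observable_def)

lemma observable_mult:
  assumes "observable f" "observable g"
  shows "observable (\<lambda>\<omega>. f \<omega> * g \<omega>)"
proof -
  obtain c d where "\<forall>\<omega>\<in>space paths. \<bar>f \<omega>\<bar> \<le> c" "\<forall>\<omega>\<in>space paths. \<bar>g \<omega>\<bar> \<le> d"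
    using assms by (auto simp: observable_def)
  then have "\<bar>f \<omega> * g \<omega>\<bar> \<le> c * d" if "\<omega> \<in> space paths" for \<omega>
    unfolding abs_mult using that by (intro mult_mono) (auto intro: order_trans[OF abs_ge_zero])
  then show ?thesis
    using assms unfolding observable_def by (auto intro!: borel_measurable_times)
qed

lemma observable_add:
  assumes "observable f" "observable g"
  shows "observable (\<lambda>\<omega>. f \<omega> + g \<omega>)"
proof -
  obtain c d where "\<forall>\<omega>\<in>space paths. \<bar>f \<omega>\<bar> \<le> c" "\<forall>\<omega>\<in>space paths. \<bar>g \<omega>\<bar> \<le> d"
    using assms by (auto simp: observable_def)
  then have "\<bar>f \<omega> + g \<omega>\<bar> \<le> c + d" if "\<omega> \<in> space paths" for \<omega>
    using that abs_triangle_ineq[of "f \<omega>" "g \<omega>"] by force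
  then show ?thesis
    using assms unfolding observable_def by (auto intro!: borel_measurable_add)
qed

lemma observable_diff:
  assumes "observable f" "observable g"
  shows "observable (\<lambda>\<omega>. f \<omega> - g \<omega>)"
  using observable_add[OF assms(1) observable_mult[OF observable_const[of "- 1"] assms(2)]] by simp

lemma observable_sum:
  "(\<And>i. i \<in> I \<Longrightarrow> observable (f i)) \<Longrightarrow> observable (\<lambda>\<omega>. \<Sum>i\<in>I. f i \<omega>)"
  by (induction I rule: infinite_finite_induct) (auto intro: observable_add)

lemma observable_of_bool:
  assumes "{\<omega> \<in> space paths. Q \<omega>} \<in> sets paths"
  shows "observable (\<lambda>\<omega>. of_bool (Q \<omega>))"
proof -
  have "(\<lambda>\<omega>. of_bool (Q \<omega>) :: real) \<in> borel_measurable paths \<longleftrightarrow>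
      indicat_real {\<omega> \<in> space paths. Q \<omega>} \<in> borel_measurable paths"
    by (intro measurable_cong) (auto simp: indicator_def)
  then show ?thesis
    using assms by (auto simp: observable_def intro!: exI[of _ 1])
qed

lemma observable_coord: "observable (\<lambda>\<omega>. g (\<omega> i))"
proof -
  have "(\<lambda>\<omega>. g (\<omega> i)) \<in> borel_measurable paths"
    by (rule measurable_compose[OF measurable_coord]) simp
  moreover have "\<bar>g (\<omega> i)\<bar> \<le> (\<Sum>x\<in>V. \<bar>g x\<bar>)" if "\<omega> \<in> space paths" for \<omega>
    using that by (intro member_le_sum) (auto simp: space_paths finite_V)
  ultimately show ?thesis by (auto simp: observable_def)
qed

lemma observable_compose:
  assumes "observable f" "g \<in> paths \<rightarrow>\<^sub>M paths"
  shows "observable (\<lambda>\<omega>. f (g \<omega>))"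
  using assms measurable_space[OF assms(2)]
  by (auto simp: observable_def intro: measurable_compose[OF assms(2)])

lemma integrable_observable:
  assumes "prob_vector V init" "observable f"
  shows "integrable (chain V p init) f"
proof -
  interpret prob_space "chain V p init" by (rule prob_space_chain_init[OF assms(1)])
  obtain c where "\<forall>\<omega>\<in>space paths. \<bar>f \<omega>\<bar> \<le> c"
    using assms by (auto simp: observable_def)
  then show ?thesis
    using assms by (intro integrable_const_bound[of _ c])
      (auto simp: observable_def space_paths cong: measurable_cong_sets)
qed

lemma nn_integral_chain:
  assumes "prob_vector V init" "f \<in> borel_measurable paths"
  shows "(\<integral>\<^sup>+\<omega>. f \<omega> \<partial>chain V p init) = (\<Sum>x\<in>V. ennreal (init x) * (\<integral>\<^sup>+\<omega>. f \<omega> \<partial>chain_from x))"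
proof -
  have K: "chain_from \<in> point_measure V (\<lambda>x. ennreal (init x)) \<rightarrow>\<^sub>M subprob_algebra paths"
    by (auto simp: measurable_point_measure_eq1 space_subprob_algebra prob_vector_indicator
        intro!: prob_space_imp_subprob_space prob_space_chain_init)
  show ?thesis
    unfolding chain_eq_bind[OF assms(1)] nn_integral_bind[OF assms(2) K]
    by (simp add: nn_integral_point_measure_finite finite_V)
qed

text \<open>Adding the bound c makes f nonnegative and reduces the claim to
  \<open>nn_integral_chain\<close>; the constant cancels because \<open>init\<close> sums to
  1.\<close>

lemma integral_chain:
  assumes init: "prob_vector V init" and f: "observable f"
  shows "(\<integral>\<omega>. f \<omega> \<partial>chain V p init) = (\<Sum>x\<in>V. init x * (\<integral>\<omega>. f \<omega> \<partial>chain_from x))"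
proof -
  obtain c where c: "\<And>\<omega>. \<omega> \<in> space paths \<Longrightarrow> \<bar>f \<omega>\<bar> \<le> c"
    using f by (auto simp: observable_def)
  have shifted: "ennreal ((\<integral>\<omega>. f \<omega> \<partial>chain V p i) + c) = (\<integral>\<^sup>+\<omega>. ennreal (f \<omega> + c) \<partial>chain V p i)"
    and nonneg: "0 \<le> (\<integral>\<omega>. f \<omega> \<partial>chain V p i) + c"
    if i: "prob_vector V i" for i
  proof -
    interpret prob_space "chain V p i" by (rule prob_space_chain_init[OF i])
    have pos: "AE \<omega> in chain V p i. 0 \<le> f \<omega> + c"
    proof (rule AE_I2)
      fix \<omega> assume "\<omega> \<in> space (chain V p i)"
      then have "\<bar>f \<omega>\<bar> \<le> c" by (intro c) (simp add: i space_paths)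
      then show "0 \<le> f \<omega> + c" by linarith
    qed
    have int: "integrable (chain V p i) f" by (rule integrable_observable[OF i f])
    have eq: "(\<integral>\<omega>. f \<omega> + c \<partial>chain V p i) = (\<integral>\<omega>. f \<omega> \<partial>chain V p i) + c"
      using int by (simp add: prob_space)
    show "ennreal ((\<integral>\<omega>. f \<omega> \<partial>chain V p i) + c) = (\<integral>\<^sup>+\<omega>. ennreal (f \<omega> + c) \<partial>chain V p i)"
      unfolding eq[symmetric] using int pos by (intro nn_integral_eq_integral[symmetric]) auto
    show "0 \<le> (\<integral>\<omega>. f \<omega> \<partial>chain V p i) + c"
      unfolding eq[symmetric] by (rule integral_nonneg_AE[OF pos])
  qed
  have i0: "0 \<le> init x" if "x \<in> V" for x using init that by (simp add: prob_vector_def)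
  have "ennreal ((\<integral>\<omega>. f \<omega> \<partial>chain V p init) + c) =
      (\<Sum>x\<in>V. ennreal (init x) * ennreal ((\<integral>\<omega>. f \<omega> \<partial>chain_from x) + c))"
    using observable_measurable[OF f]
    by (simp add: shifted init nn_integral_chain[OF init] prob_vector_indicator cong: sum.cong)
  also have "\<dots> = ennreal (\<Sum>x\<in>V. init x * ((\<integral>\<omega>. f \<omega> \<partial>chain_from x) + c))"
    using i0 nonneg[OF prob_vector_indicator]
    by (subst sum_ennreal[symmetric]) (auto simp: ennreal_mult intro!: sum.cong)
  finally have "(\<integral>\<omega>. f \<omega> \<partial>chain V p init) + c =
      (\<Sum>x\<in>V. init x * ((\<integral>\<omega>. f \<omega> \<partial>chain_from x) + c))"
    using i0 nonneg[OF prob_vector_indicator] nonneg[OF init]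
    by (subst (asm) ennreal_inj) (auto intro!: sum_nonneg)
  also have "\<dots> = (\<Sum>x\<in>V. init x * (\<integral>\<omega>. f \<omega> \<partial>chain_from x)) + (\<Sum>x\<in>V. init x) * c"
    by (simp add: distrib_left sum.distrib sum_distrib_right)
  finally show ?thesis
    using init by (simp add: prob_vector_def)
qed

lemma integral_first_step:
  assumes x: "x \<in> V" and f: "observable f"
  shows "(\<integral>\<omega>. f \<omega> \<partial>chain_from x) = (\<Sum>y\<in>V. p y x * (\<integral>\<omega>. f (case_nat x \<omega>) \<partial>chain_from y))"
proof -
  note px = prob_vector_p[OF x]
  have "case_nat x \<in> chain V p (\<lambda>y. p y x) \<rightarrow>\<^sub>M paths"
    using measurable_case_nat[OF x] px by (simp cong: measurable_cong_sets)
  then have "(\<integral>\<omega>. f \<omega> \<partial>chain_from x) = (\<integral>\<omega>. f (case_nat x \<omega>) \<partial>chain V p (\<lambda>y. p y x))"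
    unfolding chain_from_distr[OF x] using observable_measurable[OF f] by (rule integral_distr)
  also have "\<dots> = (\<Sum>y\<in>V. p y x * (\<integral>\<omega>. f (case_nat x \<omega>) \<partial>chain_from y))"
    by (rule integral_chain[OF px observable_compose[OF f measurable_case_nat[OF x]]])
  finally show ?thesis .
qed

text \<open>Stands in for measurability with respect to the history up to and including time
  l.\<close>

definition adapted :: "nat \<Rightarrow> ((nat \<Rightarrow> 'a) \<Rightarrow> 'b) \<Rightarrow> bool" where
  "adapted l G \<longleftrightarrow> (\<forall>\<omega> \<omega>'. (\<forall>i\<le>l. \<omega> i = \<omega>' i) \<longrightarrow> G \<omega> = G \<omega>')"

lemma adaptedD: "adapted l G \<Longrightarrow> (\<And>i. i \<le> l \<Longrightarrow> \<omega> i = \<omega>' i) \<Longrightarrow> G \<omega> = G \<omega>'"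
  unfolding adapted_def by blast

text \<open>Induction on l by peeling off the first step: prefixing x0 turns a function adapted to
  \<open>Suc l\<close> into one adapted to l. At l = 0 an adapted G is a constant under the chain
  from x0.\<close>

lemma markov_from:
  assumes "x0 \<in> V" "x \<in> V" "observable G" "adapted l G" "observable f"
  shows "(\<integral>\<omega>. G \<omega> * of_bool (\<omega> l = x) * f (path_shift l \<omega>) \<partial>chain_from x0) =
    (\<integral>\<omega>. G \<omega> * of_bool (\<omega> l = x) \<partial>chain_from x0) * (\<integral>\<omega>. f \<omega> \<partial>chain_from x)"
  using assms
proof (induction l arbitrary: x0 G)
  case 0
  have *: "G (case_nat x0 \<omega>) = G (\<lambda>_. x0)" for \<omega>
    by (rule adaptedD[OF \<open>adapted 0 G\<close>]) simp
  have sh: "path_shift 0 \<omega> = \<omega>" for \<omega> :: "nat \<Rightarrow> 'a"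
    by (simp add: path_shift_def)
  have m: "observable (\<lambda>\<omega>. G \<omega> * of_bool (\<omega> 0 = x))"
    using 0 by (intro observable_mult observable_coord[of "\<lambda>y. of_bool (y = x)"])
  have "(\<integral>\<omega>. G \<omega> * of_bool (\<omega> 0 = x) * f \<omega> \<partial>chain_from x0)
      = G (\<lambda>_. x0) * of_bool (x0 = x) * (\<Sum>y\<in>V. p y x0 * (\<integral>\<omega>. f (case_nat x0 \<omega>) \<partial>chain_from y))"
    using integral_first_step[OF 0(1) observable_mult[OF m 0(5)]]
    by (simp add: * sum_distrib_left ac_simps)
  also have "\<dots> = G (\<lambda>_. x0) * of_bool (x0 = x) * (\<integral>\<omega>. f \<omega> \<partial>chain_from x0)"
    by (simp add: integral_first_step[OF 0(1,5)])
  also have "(\<integral>\<omega>. G \<omega> * of_bool (\<omega> 0 = x) \<partial>chain_from x0) = G (\<lambda>_. x0) * of_bool (x0 = x)"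
    using integral_first_step[OF 0(1) m] prob_space.prob_space[OF prob_space_chain_init[OF prob_vector_indicator]]
    by (simp add: * sum_distrib_right[symmetric] sum_p 0 del: space_chain cong: sum.cong)
  then have "G (\<lambda>_. x0) * of_bool (x0 = x) * (\<integral>\<omega>. f \<omega> \<partial>chain_from x0) =
      (\<integral>\<omega>. G \<omega> * of_bool (\<omega> 0 = x) \<partial>chain_from x0) * (\<integral>\<omega>. f \<omega> \<partial>chain_from x)"
    by simp
  finally show ?case unfolding sh .
next
  case (Suc l)
  have x0: "x0 \<in> V" and G: "observable G" by fact+
  have at: "observable (\<lambda>\<omega>. of_bool (\<omega> (Suc l) = x))"
    by (rule observable_coord)
  have sh: "path_shift (Suc l) (case_nat x0 \<omega>) = path_shift l \<omega>" for \<omega>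
    by (simp add: path_shift_def)
  have G': "observable (\<lambda>\<omega>. G (case_nat x0 \<omega>))"
    by (rule observable_compose[OF G measurable_case_nat[OF x0]])
  have a: "adapted l (\<lambda>\<omega>. G (case_nat x0 \<omega>))"
    unfolding adapted_def by (intro allI impI adaptedD[OF Suc.prems(4)]) (auto split: nat.split)
  have "(\<integral>\<omega>. G \<omega> * of_bool (\<omega> (Suc l) = x) * f (path_shift (Suc l) \<omega>) \<partial>chain_from x0) =
    (\<Sum>y\<in>V. p y x0 * (\<integral>\<omega>. G (case_nat x0 \<omega>) * of_bool (\<omega> l = x) * f (path_shift l \<omega>) \<partial>chain_from y))"
    using integral_first_step[OF x0 observable_mult[OF observable_mult[OF G at]
        observable_compose[OF Suc.prems(5) measurable_path_shift]], of "Suc l"] by (simp add: sh)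
  also have "\<dots> = (\<Sum>y\<in>V. p y x0 * (\<integral>\<omega>. G (case_nat x0 \<omega>) * of_bool (\<omega> l = x) \<partial>chain_from y)) *
      (\<integral>\<omega>. f \<omega> \<partial>chain_from x)"
    using Suc.IH[OF _ Suc.prems(2) G' a Suc.prems(5)]
    by (simp add: sum_distrib_right mult.assoc cong: sum.cong)
  also have "(\<Sum>y\<in>V. p y x0 * (\<integral>\<omega>. G (case_nat x0 \<omega>) * of_bool (\<omega> l = x) \<partial>chain_from y)) =
      (\<integral>\<omega>. G \<omega> * of_bool (\<omega> (Suc l) = x) \<partial>chain_from x0)"
    using integral_first_step[OF x0 observable_mult[OF G at]] by simp
  finally show ?case .
qed

lemma markov:
  assumes init: "prob_vector V init" and "x \<in> V" "observable G" "adapted l G" "observable f"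
  shows "(\<integral>\<omega>. G \<omega> * of_bool (\<omega> l = x) * f (path_shift l \<omega>) \<partial>chain V p init) =
    (\<integral>\<omega>. G \<omega> * of_bool (\<omega> l = x) \<partial>chain V p init) * (\<integral>\<omega>. f \<omega> \<partial>chain_from x)"
proof -
  have g: "observable (\<lambda>\<omega>. G \<omega> * of_bool (\<omega> l = x))"
    by (intro observable_mult assms observable_coord[of "\<lambda>y. of_bool (y = x)"])
  have gf: "observable (\<lambda>\<omega>. G \<omega> * of_bool (\<omega> l = x) * f (path_shift l \<omega>))"
    by (intro observable_mult[OF g] observable_compose[OF assms(5)] measurable_path_shift)
  show ?thesis
    unfolding integral_chain[OF init g] integral_chain[OF init gf]
    using markov_from[OF _ assms(2-5)] by (simp add: sum_distrib_right mult.assoc cong: sum.cong)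
qed

lemma integral_start_from: "x \<in> V \<Longrightarrow> (\<integral>\<omega>. g (\<omega> 0) \<partial>chain_from x) = (g x :: real)"
  using integral_first_step[OF _ observable_coord[of g 0], of x]
    prob_space.prob_space[OF prob_space_chain_init[OF prob_vector_indicator]]
  by (simp add: sum_distrib_right[symmetric] sum_p del: space_chain cong: sum.cong)

lemma integral_start:
  "prob_vector V init \<Longrightarrow> (\<integral>\<omega>. g (\<omega> 0) \<partial>chain V p init) = (\<Sum>y\<in>V. init y * g y)"
  using integral_chain[OF _ observable_coord[of g 0]]
  by (simp add: integral_start_from cong: sum.cong)

lemma integral_step:
  "x \<in> V \<Longrightarrow> (\<integral>\<omega>. g (\<omega> (Suc 0)) \<partial>chain_from x) = (\<Sum>y\<in>V. p y x * g y)"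
  using integral_first_step[OF _ observable_coord[of g "Suc 0"], of x]
  by (simp add: integral_start_from cong: sum.cong)

end

section \<open>A strong law for martingale differences\<close>

text \<open>With j the integer square root of n, at most 2j steps separate n from the square of j.
  They change s by at most 2cj, which is negligible after division by n.\<close>

lemma average_tendsto_zero_of_squares:
  fixes s :: "nat \<Rightarrow> real"
  assumes inc: "\<And>n. \<bar>s (Suc n) - s n\<bar> \<le> c"
    and sq: "(\<lambda>j. s (j\<^sup>2) / real (j\<^sup>2)) \<longlonglongrightarrow> 0"
  shows "(\<lambda>n. s n / real n) \<longlonglongrightarrow> 0"
proof (rule tendsto_0_le[where K=1])
  let ?b = "\<lambda>j. \<bar>s (j\<^sup>2) / real (j\<^sup>2)\<bar> + 2 * c / real j"
  have c: "0 \<le> c" using inc[of 0] by (rule order_trans[OF abs_ge_zero])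
  have far: "\<bar>s (m + d) - s m\<bar> \<le> c * real d" for m d
  proof (induction d)
    case (Suc d)
    then show ?case using inc[of "m + d"] by (simp add: algebra_simps)
  qed simp
  have "filterlim floor_sqrt at_top at_top"
    unfolding filterlim_at_top
  proof
    fix k
    have "k \<le> floor_sqrt n" if "k\<^sup>2 \<le> n" for n
      using mono_floor_sqrt'[OF that] by simp
    then show "eventually (\<lambda>n. k \<le> floor_sqrt n) sequentially"
      by (auto simp: eventually_sequentially)
  qed
  moreover have "?b \<longlonglongrightarrow> \<bar>0\<bar> + 0"
    using sq by (intro tendsto_add tendsto_rabs lim_const_over_n)
  ultimately show "(\<lambda>n. ?b (floor_sqrt n)) \<longlonglongrightarrow> 0"
    by (auto intro: filterlim_compose)
  show "\<forall>\<^sub>F n in sequentially. norm (s n / real n) \<le> norm (?b (floor_sqrt n)) * 1"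
  proof (rule eventually_sequentiallyI[of 1])
    fix n :: nat assume n: "1 \<le> n"
    define j where "j = floor_sqrt n"
    have j: "0 < j" "j\<^sup>2 \<le> n" using n by (auto simp: j_def)
    have "n < (Suc j)\<^sup>2" unfolding j_def by (rule Suc_floor_sqrt_power2_gt)
    then have "n - j\<^sup>2 \<le> 2 * j" by (simp add: power2_eq_square)
    then have "c * real (n - j\<^sup>2) \<le> c * real (2 * j)"
      using c by (intro mult_left_mono) (simp_all only: of_nat_le_iff)
    moreover have "\<bar>s n - s (j\<^sup>2)\<bar> \<le> c * real (n - j\<^sup>2)"
      using far[of "j\<^sup>2" "n - j\<^sup>2"] j(2) by simp
    ultimately have "\<bar>s n\<bar> \<le> \<bar>s (j\<^sup>2)\<bar> + c * (2 * real j)"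
      by simp
    then have "\<bar>s n\<bar> / real n \<le> (\<bar>s (j\<^sup>2)\<bar> + c * (2 * real j)) / real n"
      by (intro divide_right_mono) auto
    also have "\<dots> \<le> (\<bar>s (j\<^sup>2)\<bar> + c * (2 * real j)) / real (j\<^sup>2)"
      using j c n by (intro divide_left_mono) (auto simp del: of_nat_power intro!: mult_pos_pos)
    also have "\<dots> = ?b j"
      using j by (simp add: field_simps power2_eq_square)
    finally show "norm (s n / real n) \<le> norm (?b (floor_sqrt n)) * 1"
      by (simp add: j_def)
  qed
qed

text \<open>Along n = (j + 1)^2 the second moment of the average is at most C / n, which is summable
  in j. Hence the squared averages have an almost surely finite sum and tend to 0; bounded
  increments fill the gaps between squares.\<close>

lemma (in prob_space) strong_law_of_linear_variance:
  fixes D :: "nat \<Rightarrow> 'a \<Rightarrow> real"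
  assumes [measurable]: "\<And>l. D l \<in> borel_measurable M"
    and bound: "\<And>l \<omega>. \<omega> \<in> space M \<Longrightarrow> \<bar>D l \<omega>\<bar> \<le> c"
    and var: "\<And>n. expectation (\<lambda>\<omega>. (\<Sum>l<n. D l \<omega>)\<^sup>2) \<le> C * real n"
  shows "AE \<omega> in M. (\<lambda>n. (\<Sum>l<n. D l \<omega>) / real n) \<longlonglongrightarrow> 0"
proof -
  have divide_power2: "c * r / r\<^sup>2 = c * (1 / r)" if "r > 0" for c r :: real
    using that by (simp add: power2_eq_square)
  define S where "S n \<omega> = (\<Sum>l<n. D l \<omega>)" for n \<omega>
  \<comment> \<open>The index \<open>Suc j\<close> keeps the denominator positive.\<close>
  define g where "g j \<omega> = (S ((Suc j)\<^sup>2) \<omega> / real ((Suc j)\<^sup>2))\<^sup>2" for j \<omega>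
  have [measurable]: "S n \<in> borel_measurable M" for n unfolding S_def by measurable
  have [measurable]: "g n \<in> borel_measurable M" for n unfolding g_def by measurable
  have Sb: "\<bar>S n \<omega>\<bar> \<le> real n * c" if "\<omega> \<in> space M" for n \<omega>
    using sum_norm_bound[of "{..<n}" "\<lambda>l. D l \<omega>" c] bound[OF that] by (simp add: S_def)
  have intS: "integrable M (\<lambda>\<omega>. (S n \<omega>)\<^sup>2)" for n
    using power_mono[OF Sb, of _ n 2]
    by (intro integrable_const_bound[of _ "(real n * c)\<^sup>2"]) auto
  have "(\<integral>\<^sup>+\<omega>. ennreal (g j \<omega>) \<partial>M) \<le> ennreal (C * (1 / real ((Suc j)\<^sup>2)))" for j
  proof -
    have "(\<integral>\<^sup>+\<omega>. ennreal (g j \<omega>) \<partial>M) = ennreal (expectation (\<lambda>\<omega>. (S ((Suc j)\<^sup>2) \<omega>)\<^sup>2 / (real ((Suc j)\<^sup>2))\<^sup>2))"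
      unfolding g_def power_divide using intS by (intro nn_integral_eq_integral) auto
    also have "\<dots> \<le> ennreal (C * real ((Suc j)\<^sup>2) / (real ((Suc j)\<^sup>2))\<^sup>2)"
      using var[of "(Suc j)\<^sup>2"] by (intro ennreal_leI) (simp add: S_def divide_right_mono)
    also have "C * real ((Suc j)\<^sup>2) / (real ((Suc j)\<^sup>2))\<^sup>2 = C * (1 / real ((Suc j)\<^sup>2))"
      using divide_power2[of "real ((Suc j)\<^sup>2)" C] by (simp del: of_nat_power)
    finally show ?thesis .
  qed
  moreover have C: "0 \<le> C"
  proof -
    have nonneg: "0 \<le> expectation (\<lambda>\<omega>. (\<Sum>l<1. D l \<omega>)\<^sup>2)" by (intro integral_nonneg_AE) simp
    show ?thesis using order_trans[OF nonneg var[of 1]] by simp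
  qed
  moreover have sm: "summable (\<lambda>j. C * (1 / real ((Suc j)\<^sup>2)))"
    using inverse_power_summable[of 2, where 'a=real]
    by (intro summable_mult) (subst summable_Suc_iff, simp add: inverse_eq_divide)
  ultimately have "(\<integral>\<^sup>+\<omega>. (\<Sum>j. ennreal (g j \<omega>)) \<partial>M) \<le> (\<Sum>j. ennreal (C * (1 / real ((Suc j)\<^sup>2))))"
    by (subst nn_integral_suminf) (auto intro!: suminf_le)
  also have "\<dots> = ennreal (\<Sum>j. C * (1 / real ((Suc j)\<^sup>2)))"
    using C sm by (intro suminf_ennreal2) auto
  also have "\<dots> < \<infinity>" by simp
  finally have "AE \<omega> in M. (\<Sum>j. ennreal (g j \<omega>)) \<noteq> \<infinity>"
    by (intro nn_integral_PInf_AE) auto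
  with AE_space show ?thesis
  proof eventually_elim
    fix \<omega> assume \<omega>: "\<omega> \<in> space M" and fin: "(\<Sum>j. ennreal (g j \<omega>)) \<noteq> \<infinity>"
    have "summable (\<lambda>j. g j \<omega>)"
      using fin by (intro summable_suminf_not_top) (auto simp: g_def)
    then have "(\<lambda>j. sqrt (g j \<omega>)) \<longlonglongrightarrow> sqrt 0"
      by (intro tendsto_real_sqrt summable_LIMSEQ_zero)
    then have "(\<lambda>j. S ((Suc j)\<^sup>2) \<omega> / real ((Suc j)\<^sup>2)) \<longlonglongrightarrow> 0"
      by (simp only: g_def real_sqrt_abs real_sqrt_zero tendsto_rabs_zero_iff)
    then have "(\<lambda>j. S (j\<^sup>2) \<omega> / real (j\<^sup>2)) \<longlonglongrightarrow> 0"
      by (rule LIMSEQ_imp_Suc)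
    then have "(\<lambda>n. S n \<omega> / real n) \<longlonglongrightarrow> 0"
      using bound[OF \<omega>] by (intro average_tendsto_zero_of_squares[of _ c]) (auto simp: S_def)
    then show "(\<lambda>n. (\<Sum>l<n. D l \<omega>) / real n) \<longlonglongrightarrow> 0" by (simp add: S_def)
  qed
qed

text \<open>Only visits strictly before n count. At an entrance the value therefore still shows the
  previous state in D, and the value at \<open>Suc l\<close> is known at time l, so it may weight
  the step from l to \<open>Suc l\<close>.\<close>

primrec last_visit :: "'a set \<Rightarrow> 'a \<Rightarrow> (nat \<Rightarrow> 'a) \<Rightarrow> nat \<Rightarrow> 'a" where
  "last_visit D b \<omega> 0 = b"
| "last_visit D b \<omega> (Suc n) = (if \<omega> n \<in> D then \<omega> n else last_visit D b \<omega> n)"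

lemma last_visit_cong: "(\<And>i. i < n \<Longrightarrow> \<omega> i = \<omega>' i) \<Longrightarrow> last_visit D b \<omega> n = last_visit D b \<omega>' n"
  by (induction n) auto

lemma last_visit_in: "b \<in> D \<Longrightarrow> last_visit D b \<omega> n \<in> D"
  by (induction n) auto

section \<open>Martingale differences along the chain\<close>

context finite_chain
begin

lemma observable_last_visit: "observable (\<lambda>\<omega>. of_bool (last_visit D b \<omega> n = s))"
proof (induction n)
  case (Suc n)
  have eq: "of_bool (last_visit D b \<omega> (Suc n) = s) =
    (of_bool (\<omega> n \<in> D \<and> \<omega> n = s) :: real) + of_bool (\<omega> n \<notin> D) * of_bool (last_visit D b \<omega> n = s)" for \<omega>
    by simp
  show ?case
    unfolding eq by (intro observable_add observable_mult Suc
        observable_coord[of "\<lambda>y. of_bool (y \<in> D \<and> y = s)"] observable_coord[of "\<lambda>y. of_bool (y \<notin> D)"])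
qed simp

text \<open>Splitting over the value x of the path at time l, the Markov property replaces the value
  of g at the next state by its one-step mean from x.\<close>

lemma martingale_increment:
  assumes init: "prob_vector V init" and H: "observable H" "adapted l H"
  shows "(\<integral>\<omega>. H \<omega> * (g (\<omega> (Suc l)) - (\<Sum>y\<in>V. p y (\<omega> l) * g y)) \<partial>chain V p init) = 0"
proof -
  let ?E = "integral\<^sup>L (chain V p init)"
  let ?m = "\<lambda>x. \<Sum>y\<in>V. p y x * g y"
  have at: "observable (\<lambda>\<omega>. H \<omega> * of_bool (\<omega> l = x))" for x
    by (intro observable_mult H observable_coord[of "\<lambda>y. of_bool (y = x)"])
  have step: "observable (\<lambda>\<omega>. g (\<omega> i))" for i by (rule observable_coord)
  have "?E (\<lambda>\<omega>. H \<omega> * (g (\<omega> (Suc l)) - ?m (\<omega> l))) =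
    ?E (\<lambda>\<omega>. \<Sum>x\<in>V. H \<omega> * of_bool (\<omega> l = x) * g (path_shift l \<omega> (Suc 0)) - H \<omega> * of_bool (\<omega> l = x) * ?m x)"
  proof (rule Bochner_Integration.integral_cong[OF refl])
    fix \<omega> assume "\<omega> \<in> space (chain V p init)"
    then have "\<omega> l \<in> V" using init by simp
    then show "H \<omega> * (g (\<omega> (Suc l)) - ?m (\<omega> l)) =
      (\<Sum>x\<in>V. H \<omega> * of_bool (\<omega> l = x) * g (path_shift l \<omega> (Suc 0)) - H \<omega> * of_bool (\<omega> l = x) * ?m x)"
      using finite_V by (subst sum.remove[of _ "\<omega> l"]) (auto simp: path_shift_def algebra_simps intro!: sum.neutral)
  qed
  also have "\<dots> = (\<Sum>x\<in>V. ?E (\<lambda>\<omega>. H \<omega> * of_bool (\<omega> l = x) * g (path_shift l \<omega> (Suc 0))) -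
      ?E (\<lambda>\<omega>. H \<omega> * of_bool (\<omega> l = x) * ?m x))"
  proof -
    have a: "integrable (chain V p init) (\<lambda>\<omega>. H \<omega> * of_bool (\<omega> l = x) * g (path_shift l \<omega> (Suc 0)))" for x
      by (intro integrable_observable[OF init] observable_mult at observable_compose[OF step measurable_path_shift])
    have b: "integrable (chain V p init) (\<lambda>\<omega>. H \<omega> * of_bool (\<omega> l = x) * ?m x)" for x
      by (intro integrable_observable[OF init] observable_mult at observable_const)
    show ?thesis
      using a b by (subst Bochner_Integration.integral_sum) (auto intro!: sum.cong)
  qed
  also have "\<dots> = 0"
    using markov[OF init _ H step] integral_step[of _ g]
    by (intro sum.neutral) simp
  finally show ?thesis .
qed

text \<open>A martingale difference: the weight depends on times up to l, and the other factor is
  centred given the path up to l.\<close>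

definition increment :: "'a set \<Rightarrow> 'a \<Rightarrow> 'a \<Rightarrow> 'a \<Rightarrow> nat \<Rightarrow> (nat \<Rightarrow> 'a) \<Rightarrow> real" where
  "increment D b s z l \<omega> =
     of_bool (last_visit D b \<omega> (Suc l) = s) * (of_bool (\<omega> (Suc l) = z) - p z (\<omega> l))"

lemma p_le_1: "x \<in> V \<Longrightarrow> y \<in> V \<Longrightarrow> p y x \<le> 1"
  using member_le_sum[of y V "\<lambda>y. p y x"] p_nonneg finite_V sum_p by fastforce

text \<open>The past sum is uncorrelated with the next increment, so the second moment grows by at
  most 1 per step.\<close>

lemma strong_law_increment:
  assumes init: "prob_vector V init" and z: "z \<in> V"
  shows "AE \<omega> in chain V p init. (\<lambda>n. (\<Sum>l<n. increment D b s z l \<omega>) / real n) \<longlonglongrightarrow> 0"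
proof -
  interpret P: prob_space "chain V p init" by (rule prob_space_chain_init[OF init])
  let ?I = "increment D b s z"
  have obs: "observable (?I l)" for l
    unfolding increment_def by (intro observable_mult observable_last_visit observable_diff
        observable_coord[of "\<lambda>y. of_bool (y = z)"] observable_coord[of "p z"])
  have obsS: "observable (\<lambda>\<omega>. \<Sum>l<n. ?I l \<omega>)" for n
    by (intro observable_sum obs)
  have bound: "\<bar>?I l \<omega>\<bar> \<le> 1" if "\<omega> \<in> space (chain V p init)" for l \<omega>
  proof -
    have "\<omega> l \<in> V" using that init by simp
    then show ?thesis
      using p_le_1[of "\<omega> l" z] p_nonneg[of "\<omega> l" z] z by (auto simp: increment_def of_bool_def)
  qed
  have orth: "P.expectation (\<lambda>\<omega>. (\<Sum>l<n. ?I l \<omega>) * ?I n \<omega>) = 0" for n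
  proof -
    \<comment> \<open>The weight of the new increment is moved into the past factor, which stays
      adapted to time n; what remains is the centred indicator.\<close>
    let ?H = "\<lambda>\<omega>. (\<Sum>l<n. ?I l \<omega>) * of_bool (last_visit D b \<omega> (Suc n) = s)"
    have "observable ?H" by (intro observable_mult obsS observable_last_visit)
    moreover have "adapted n ?H"
      unfolding adapted_def
    proof (intro allI impI)
      fix \<omega> \<omega>' :: "nat \<Rightarrow> 'a" assume eq: "\<forall>i\<le>n. \<omega> i = \<omega>' i"
      then have lv: "last_visit D b \<omega> i = last_visit D b \<omega>' i" if "i \<le> Suc n" for i
        using that by (intro last_visit_cong) auto
      have "?I l \<omega> = ?I l \<omega>'" if "l < n" for l
        unfolding increment_def using that eq lv[of "Suc l"] by simp
      then show "?H \<omega> = ?H \<omega>'" using lv[of "Suc n"] by simp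
    qed
    ultimately have "P.expectation (\<lambda>\<omega>. ?H \<omega> * (of_bool (\<omega> (Suc n) = z) - (\<Sum>y\<in>V. p y (\<omega> n) * of_bool (y = z)))) = 0"
      by (rule martingale_increment[OF init])
    moreover have "(\<Sum>y\<in>V. p y x * of_bool (y = z)) = p z x" for x
      using z finite_V by (simp add: of_bool_def if_distrib[of "\<lambda>t. p _ x * t"] cong: if_cong)
    ultimately show ?thesis
      by (simp only: increment_def mult.assoc)
  qed
  have "P.expectation (\<lambda>\<omega>. (\<Sum>l<n. ?I l \<omega>)\<^sup>2) \<le> 1 * real n" for n
  proof (induction n)
    case (Suc n)
    have sq: "(\<Sum>l<Suc n. ?I l \<omega>)\<^sup>2 = (\<Sum>l<n. ?I l \<omega>)\<^sup>2 + 2 * ((\<Sum>l<n. ?I l \<omega>) * ?I n \<omega>) + (?I n \<omega>)\<^sup>2" for \<omega>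
      by (simp add: power2_sum)
    have i1: "integrable (chain V p init) (\<lambda>\<omega>. (\<Sum>l<n. ?I l \<omega>)\<^sup>2)"
      and i2: "integrable (chain V p init) (\<lambda>\<omega>. (\<Sum>l<n. ?I l \<omega>) * ?I n \<omega>)"
      and i3: "integrable (chain V p init) (\<lambda>\<omega>. (?I n \<omega>)\<^sup>2)"
      unfolding power2_eq_square
      by (intro integrable_observable[OF init] observable_mult obsS obs)+
    have "P.expectation (\<lambda>\<omega>. (?I n \<omega>)\<^sup>2) \<le> P.expectation (\<lambda>_. 1)"
      using i3 bound by (intro integral_mono) (auto simp: abs_square_le_1)
    then show ?case
      unfolding sq using i1 i2 i3 orth[of n] Suc by (simp add: P.prob_space del: space_chain)
  qed simp
  then show ?thesis
    using obs[THEN observable_measurable] bound init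
    by (intro P.strong_law_of_linear_variance[of _ 1 1]) (auto cong: measurable_cong_sets)
qed

end

section \<open>Limits of empirical measures\<close>

lemma convergent_subsequence_family:
  fixes X :: "'i \<Rightarrow> nat \<Rightarrow> real"
  assumes "finite I" "\<And>i. i \<in> I \<Longrightarrow> bounded (range (X i))"
  shows "\<exists>r. strict_mono (r :: nat \<Rightarrow> nat) \<and> (\<forall>i\<in>I. convergent (X i \<circ> r))"
  using assms
proof (induction I)
  case empty
  show ?case by (intro exI[of _ id]) (simp add: strict_mono_def)
next
  case (insert i I)
  then obtain r :: "nat \<Rightarrow> nat" where r: "strict_mono r" "\<forall>j\<in>I. convergent (X j \<circ> r)"
    by blast
  have "bounded (range (X i \<circ> r))"
    by (rule bounded_subset[of "range (X i)"]) (auto simp: insert)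
  then obtain l r' where r': "strict_mono r'" "((X i \<circ> r) \<circ> r') \<longlonglongrightarrow> l"
    using bounded_imp_convergent_subsequence[of "X i \<circ> r"] by auto
  have "convergent (X j \<circ> (r \<circ> r'))" if "j \<in> insert i I" for j
  proof (cases "j = i")
    case True
    then show ?thesis using r'(2) by (auto simp: convergent_def comp_assoc)
  next
    case False
    then show ?thesis
      using that r(2) convergent_subseq_convergent[OF _ r'(1), of "X j \<circ> r"] by (auto simp: comp_assoc)
  qed
  then show ?case
    using strict_mono_o[OF r(1) r'(1)] by blast
qed

text \<open>Turns uniqueness of limit points into convergence.\<close>

lemma tendsto_of_subsequences:
  fixes X :: "nat \<Rightarrow> real"
  assumes "\<And>r. strict_mono (r :: nat \<Rightarrow> nat) \<Longrightarrow> \<exists>r'. strict_mono (r' :: nat \<Rightarrow> nat) \<and> (X \<circ> r \<circ> r') \<longlonglongrightarrow> c"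
  shows "X \<longlonglongrightarrow> c"
proof (rule ccontr)
  assume "\<not> X \<longlonglongrightarrow> c"
  then obtain e where e: "0 < e" and "\<not> (\<forall>\<^sub>F n in sequentially. dist (X n) c < e)"
    by (auto simp: tendsto_iff)
  then have "infinite {n. \<not> dist (X n) c < e}"
    by (simp add: cofinite_eq_sequentially[symmetric] eventually_cofinite)
  then obtain r :: "nat \<Rightarrow> nat" where r: "strict_mono r" "\<And>n. \<not> dist (X (r n)) c < e"
    using infinite_enumerate by blast
  obtain r' where "(X \<circ> r \<circ> r') \<longlonglongrightarrow> c"
    using assms[OF r(1)] by blast
  then have "\<forall>\<^sub>F n in sequentially. dist (X (r (r' n))) c < e"
    using e by (auto simp: tendsto_iff)
  then show False using r(2) by simp
qed

lemma bounded_over_n_tendsto_zero: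
  fixes d :: "nat \<Rightarrow> real"
  assumes "\<And>n. \<bar>d n\<bar> \<le> K"
  shows "(\<lambda>n. d n / real n) \<longlonglongrightarrow> 0"
proof (rule tendsto_0_le[where K=1, OF lim_const_over_n[of K]])
  show "\<forall>\<^sub>F n in sequentially. norm (d n / real n) \<le> norm (K / real n) * 1"
    using assms order_trans[OF abs_ge_zero assms]
    by (intro always_eventually allI) (simp add: divide_right_mono)
qed

lemma sum_shift_bounded:
  fixes f :: "nat \<Rightarrow> real"
  assumes "\<And>n. 0 \<le> f n" "\<And>n. f n \<le> 1"
  shows "\<bar>(\<Sum>l<n. f l) - (\<Sum>l<n. f (Suc l))\<bar> \<le> 1"
proof -
  have "(\<Sum>l<n. f l) - (\<Sum>l<n. f (Suc l)) = f 0 - f n"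
    using sum.lessThan_Suc_shift[of f n] sum.lessThan_Suc[of f n] by simp
  then show ?thesis using assms[of 0] assms[of n] by (auto simp: abs_if)
qed

section \<open>Irreducibility, the Dirichlet problem and the invariant measure\<close>

locale stationary_chain = finite_chain +
  fixes m :: "'a \<Rightarrow> real"
  assumes irreducible: "irreducible_chain V p" and invariant: "invariant_measure V p m"
begin

text \<open>The form in which irreducibility is used throughout. A positive k-step probability
  splits into a positive last jump and a positive probability for the steps before it, so C is never
  left.\<close>

lemma closed_eq_V:
  assumes "C \<subseteq> V" "C \<noteq> {}" and cl: "\<And>x y. x \<in> C \<Longrightarrow> y \<in> V \<Longrightarrow> 0 < p y x \<Longrightarrow> y \<in> C"
  shows "C = V"
proof
  have reach: "y \<in> C" if "x \<in> C" "y \<in> V" "0 < kstep V p k y x" for k x y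
    using that
  proof (induction k arbitrary: y)
    case (Suc k)
    then obtain z where z: "z \<in> V" "0 < p y z * kstep V p k z x"
      by (force simp: not_le[symmetric] intro: sum_nonpos)
    then have "0 < p y z"
      using p_nonneg[of z y] Suc.prems by (cases "p y z = 0") auto
    moreover from this z have "0 < kstep V p k z x"
      by (simp add: zero_less_mult_iff)
    ultimately show ?case
      using z Suc cl by blast
  qed (simp split: if_splits)
  show "V \<subseteq> C"
    using assms(1,2) irreducible reach unfolding irreducible_chain_def by blast
qed fact

text \<open>The set where u is positive is closed under possible jumps, because
  \<open>u y \<ge> p y x * u x\<close>.\<close>

lemma superinvariant_positive:
  assumes "\<And>z. z \<in> V \<Longrightarrow> 0 \<le> u z" "\<And>z. z \<in> V \<Longrightarrow> (\<Sum>y\<in>V. p z y * u y) \<le> u z"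
    and "x \<in> V" "0 < u x" "z \<in> V"
  shows "0 < u z"
proof -
  have "{x\<in>V. 0 < u x} = V"
  proof (rule closed_eq_V)
    fix x y assume x: "x \<in> {x\<in>V. 0 < u x}" and y: "y \<in> V" "0 < p y x"
    then have "0 < p y x * u x" by simp
    also have "\<dots> \<le> (\<Sum>x\<in>V. p y x * u x)"
      using x y finite_V by (intro member_le_sum) (auto intro!: mult_nonneg_nonneg p_nonneg assms)
    also have "\<dots> \<le> u y" by (rule assms(2)[OF y(1)])
    finally show "y \<in> {x\<in>V. 0 < u x}" using y by simp
  qed (use assms in auto)
  then show ?thesis using assms by auto
qed

text \<open>Conservation of mass.\<close>

lemma sum_transition: "(\<Sum>z\<in>V. \<Sum>y\<in>V. p z y * u y) = (\<Sum>y\<in>V. u y)"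
  by (subst sum.swap) (simp add: sum_distrib_right[symmetric] sum_p)

text \<open>The Dirichlet problem for measures. Mass conservation forces the subinvariant
  function \<open>\<bar>u\<bar>\<close> to be invariant, so its zeros on \<open>D\<close> propagate.\<close>

lemma dirichlet_zero:
  assumes D: "D \<subseteq> V" "D \<noteq> {}" and u0: "\<And>z. z \<in> D \<Longrightarrow> u z = 0"
    and u: "\<And>z. z \<in> V - D \<Longrightarrow> u z = (\<Sum>y\<in>V. p z y * u y)" and "z \<in> V"
  shows "u z = 0"
proof (rule ccontr)
  assume nz: "u z \<noteq> 0"
  let ?d = "\<lambda>z. (\<Sum>y\<in>V. p z y * \<bar>u y\<bar>) - \<bar>u z\<bar>"
  have nonneg: "0 \<le> ?d z" if z: "z \<in> V" for z
  proof (cases "z \<in> D")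
    case True
    then show ?thesis using z u0 by (simp add: sum_nonneg p_nonneg)
  next
    case False
    then have "\<bar>u z\<bar> \<le> (\<Sum>y\<in>V. \<bar>p z y * u y\<bar>)"
      using u[of z] z by (simp add: sum_abs)
    then show ?thesis using z p_nonneg by (simp add: abs_mult cong: sum.cong)
  qed
  have "(\<Sum>z\<in>V. ?d z) = 0"
    by (simp add: sum_subtractf sum_transition)
  then have eq: "?d z = 0" if "z \<in> V" for z
    using that nonneg finite_V sum_nonneg_eq_0_iff[of V ?d] by auto
  obtain x where x: "x \<in> D" using D by auto
  have "0 < \<bar>u x\<bar>"
    by (rule superinvariant_positive[where u="\<lambda>z. \<bar>u z\<bar>", OF _ _ \<open>z \<in> V\<close>])
      (use eq nz x D in auto)
  then show False using u0[OF x] by simp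
qed

lemma dirichlet_unique:
  assumes "D \<subseteq> V" "D \<noteq> {}" "\<And>z. z \<in> D \<Longrightarrow> u z = v z"
    and "\<And>z. z \<in> V - D \<Longrightarrow> u z = (\<Sum>y\<in>V. p z y * u y)"
    and "\<And>z. z \<in> V - D \<Longrightarrow> v z = (\<Sum>y\<in>V. p z y * v y)" and "z \<in> V"
  shows "u z = v z"
proof -
  have "u z - v z = 0"
  proof (rule dirichlet_zero[where u="\<lambda>z. u z - v z", OF assms(1,2) _ _ \<open>z \<in> V\<close>])
    fix z assume z: "z \<in> V - D"
    show "u z - v z = (\<Sum>y\<in>V. p z y * (u y - v y))"
      using assms(4,5)[OF z] by (simp add: right_diff_distrib sum_subtractf)
  qed (simp add: assms)
  then show ?thesis by simp
qed

lemma m_nonneg: "z \<in> V \<Longrightarrow> 0 \<le> m z" and sum_m: "(\<Sum>z\<in>V. m z) = 1"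
  and m_invariant: "z \<in> V \<Longrightarrow> (\<Sum>y\<in>V. p z y * m y) = m z"
  using invariant by (auto simp: invariant_measure_def prob_vector_def mult.commute)

lemma m_pos: "z \<in> V \<Longrightarrow> 0 < m z"
proof -
  assume z: "z \<in> V"
  have "\<exists>x\<in>V. 0 < m x"
    using sum_m sum_nonpos[of V m] by (force simp: not_less)
  then show ?thesis
    using superinvariant_positive[of m _ z] z m_nonneg m_invariant by auto
qed

text \<open>Scale m so that it agrees with u at the one point z. Then u and the multiple of m solve
  the same Dirichlet problem with boundary {z}, and the total mass fixes the factor. No sign of u is
  assumed.\<close>

lemma invariant_unique:
  assumes u: "\<And>z. z \<in> V \<Longrightarrow> u z = (\<Sum>y\<in>V. p z y * u y)" and sum: "(\<Sum>z\<in>V. u z) = 1" and "z \<in> V"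
  shows "u z = m z"
proof -
  define c where "c = u z / m z"
  have eq: "u y = c * m y" if "y \<in> V" for y
  proof (rule dirichlet_unique[of "{z}" u _ y])
    fix y assume "y \<in> V - {z}"
    then show "c * m y = (\<Sum>x\<in>V. p y x * (c * m x))"
      using m_invariant[of y] by (simp add: mult.left_commute[of _ c] sum_distrib_left[symmetric])
  qed (use c_def u \<open>z \<in> V\<close> that m_pos[of z] in auto)
  then have "(\<Sum>y\<in>V. u y) = c * (\<Sum>y\<in>V. m y)"
    by (simp add: sum_distrib_left)
  then have "c = 1" using sum sum_m by simp
  then show ?thesis using m_pos[OF \<open>z \<in> V\<close>] by (simp add: c_def)
qed

end

section \<open>The empirical measure of current state and last visited state\<close>

locale reactive_chain = stationary_chain +
  fixes A B :: "'a set" and b :: 'a and qm :: "'a \<Rightarrow> real"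
  assumes A_sub: "A \<subseteq> V" and B_sub: "B \<subseteq> V" and disjoint: "A \<inter> B = {}"
    and A_ne: "A \<noteq> {}" and b: "b \<in> B" and backward: "backward_committor V p m A B qm"
begin

text \<open>The default b lies in B, so the first entrance to A counts as coming from B. This
  matches the convention \<open>entry_B A B \<omega> 0 = 0\<close>, by which the first cycle starts
  at time 0.\<close>

abbreviation "last_AB \<equiv> last_visit (A \<union> B) b"

lemma AB_sub: "A \<union> B \<subseteq> V" and AB_ne: "A \<union> B \<noteq> {}" and finite_AB: "finite (A \<union> B)"
  and finite_A: "finite A" and finite_B: "finite B"
  using A_sub B_sub A_ne finite_V by (auto intro: finite_subset)

lemma last_AB: "last_AB \<omega> n \<in> A \<union> B"
  using b by (intro last_visit_in) auto

text \<open>The stationary probability of being at \<open>y\<close> with \<open>s\<close> the last visited state of \<open>A \<union> B\<close>.\<close>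

definition last_visit_law :: "('a \<Rightarrow> 'a \<Rightarrow> real) \<Rightarrow> bool" where
  "last_visit_law e \<longleftrightarrow> (\<forall>s\<in>A \<union> B.
     (\<forall>z\<in>V - (A \<union> B). e z s = (\<Sum>y\<in>V. p z y * e y s)) \<and>
     (\<forall>z\<in>A \<union> B. e z s = (if z = s then m s else 0)))"

lemma last_visit_law_unique:
  assumes "last_visit_law e" "last_visit_law e'" "y \<in> V" "s \<in> A \<union> B"
  shows "e y s = e' y s"
  by (rule dirichlet_unique[OF AB_sub AB_ne _ _ _ \<open>y \<in> V\<close>])
    (use assms in \<open>auto simp: last_visit_law_def\<close>)

text \<open>Here the last visit includes time l itself, so a state of A \<union> B is paired only
  with itself. In \<open>transitions\<close> time l is excluded, so that an arrival in A \<union> B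
  is paired with the previous boundary state. One step of p leads from the first count to the
  second.\<close>

definition occupation :: "(nat \<Rightarrow> 'a) \<Rightarrow> 'a \<Rightarrow> 'a \<Rightarrow> nat \<Rightarrow> real" where
  "occupation \<omega> y s n = (\<Sum>l<n. of_bool (last_AB \<omega> (Suc l) = s) * of_bool (\<omega> l = y))"

definition transitions :: "(nat \<Rightarrow> 'a) \<Rightarrow> 'a \<Rightarrow> 'a \<Rightarrow> nat \<Rightarrow> real" where
  "transitions \<omega> s z n = (\<Sum>l<n. of_bool (last_AB \<omega> l = s) * of_bool (\<omega> l = z))"

text \<open>The almost sure event on which all frequency limits hold; the rest of the argument for a
  fixed path in it is deterministic.\<close>

definition generic :: "(nat \<Rightarrow> 'a) \<Rightarrow> bool" where
  "generic \<omega> \<longleftrightarrow> \<omega> \<in> space paths \<and>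
     (\<forall>s\<in>A \<union> B. \<forall>z\<in>V. (\<lambda>n. (\<Sum>l<n. increment (A \<union> B) b s z l \<omega>) / real n) \<longlonglongrightarrow> 0)"

lemma AE_generic:
  assumes "prob_vector V init"
  shows "AE \<omega> in chain V p init. generic \<omega>"
  unfolding generic_def
  using strong_law_increment[OF assms] finite_AB finite_V
  by (intro AE_conjI AE_finite_allI) (auto simp: assms space_paths)

text \<open>The sum of the increments is the time-shifted \<open>transitions\<close> count minus one
  step of p applied to \<open>occupation\<close>. The shift changes the count by at most 1, and the
  increments average to 0.\<close>

lemma transitions_balance:
  assumes "generic \<omega>" "s \<in> A \<union> B" "z \<in> V"
  shows "(\<lambda>n. transitions \<omega> s z n / real n - (\<Sum>y\<in>V. p z y * (occupation \<omega> y s n / real n))) \<longlonglongrightarrow> 0"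
proof -
  let ?f = "\<lambda>l. of_bool (last_AB \<omega> l = s) * of_bool (\<omega> l = z) :: real"
  let ?d = "\<lambda>n. (\<Sum>l<n. ?f l) - (\<Sum>l<n. ?f (Suc l))"
  let ?I = "\<lambda>n. \<Sum>l<n. increment (A \<union> B) b s z l \<omega>"
  have \<omega>: "\<omega> l \<in> V" for l using assms by (simp add: generic_def space_paths)
  have "(\<Sum>y\<in>V. p z y * occupation \<omega> y s n) =
      (\<Sum>l<n. of_bool (last_AB \<omega> (Suc l) = s) * p z (\<omega> l))" for n
  proof -
    have "(\<Sum>y\<in>V. p z y * occupation \<omega> y s n) =
        (\<Sum>l<n. of_bool (last_AB \<omega> (Suc l) = s) * (\<Sum>y\<in>V. p z y * of_bool (\<omega> l = y)))"
      unfolding occupation_def sum_distrib_left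
      by (subst sum.swap) (intro sum.cong refl, simp only: ac_simps)
    moreover have "(\<Sum>y\<in>V. p z y * of_bool (\<omega> l = y)) = p z (\<omega> l)" for l
      using finite_V \<omega>[of l] by (simp add: of_bool_def if_distrib[of "\<lambda>t. p z _ * t"] cong: if_cong)
    ultimately show ?thesis by simp
  qed
  then have "?I n = (\<Sum>l<n. ?f (Suc l)) - (\<Sum>y\<in>V. p z y * occupation \<omega> y s n)" for n
    by (simp only: increment_def right_diff_distrib sum_subtractf)
  then have eq: "transitions \<omega> s z n / real n - (\<Sum>y\<in>V. p z y * (occupation \<omega> y s n / real n)) =
      ?d n / real n + ?I n / real n" for n
    by (simp add: transitions_def add_divide_distrib diff_divide_distrib sum_divide_distrib)
  have "(\<lambda>n. ?d n / real n) \<longlonglongrightarrow> 0"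
    by (intro bounded_over_n_tendsto_zero[of _ 1] sum_shift_bounded) auto
  moreover have "(\<lambda>n. ?I n / real n) \<longlonglongrightarrow> 0"
    using assms by (simp add: generic_def)
  ultimately show ?thesis
    unfolding eq using tendsto_add by fastforce
qed

lemma occupation_eq_transitions:
  "z \<notin> A \<union> B \<Longrightarrow> occupation \<omega> z s n = transitions \<omega> s z n"
  unfolding occupation_def transitions_def by (intro sum.cong refl) auto

lemma occupation_AB:
  "z \<in> A \<union> B \<Longrightarrow> z \<noteq> s \<Longrightarrow> occupation \<omega> z s n = 0"
  by (auto simp: occupation_def intro!: sum.neutral)

lemma sum_last_AB: "(\<Sum>s\<in>A \<union> B. of_bool (last_AB \<omega> n = s) * c) = (c :: real)"
  using finite_AB last_AB[of \<omega> n] by (simp add: of_bool_def if_distrib[of "\<lambda>t. t * c"] cong: if_cong)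

lemma sum_occupation: "(\<Sum>s\<in>A \<union> B. occupation \<omega> y s n) = (\<Sum>l<n. of_bool (\<omega> l = y))"
  unfolding occupation_def by (subst sum.swap) (simp only: sum_last_AB)

lemma sum_transitions: "(\<Sum>s\<in>A \<union> B. transitions \<omega> s y n) = (\<Sum>l<n. of_bool (\<omega> l = y))"
  unfolding transitions_def by (subst sum.swap) (simp only: sum_last_AB)

text \<open>Off A \<union> B both counts agree, so the balance becomes the harmonic equation. On A
  \<union> B only diagonal pairs occur. Summed over s, both counts give the visits to a state, so
  the marginal is invariant and hence m; this fixes the diagonal values.\<close>

lemma last_visit_law_of_limit:
  assumes g: "generic \<omega>" and r: "strict_mono (r :: nat \<Rightarrow> nat)"
    and lim: "\<And>y s. y \<in> V \<Longrightarrow> s \<in> A \<union> B \<Longrightarrow> (\<lambda>j. occupation \<omega> y s (r j) / real (r j)) \<longlonglongrightarrow> e y s"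
  shows "last_visit_law e"
proof -
  have sub: "(\<lambda>j. f (r j)) \<longlonglongrightarrow> l" if "f \<longlonglongrightarrow> l" for f :: "nat \<Rightarrow> real" and l
    using LIMSEQ_subseq_LIMSEQ[OF that r] by (simp add: comp_def)
  have trans: "(\<lambda>j. transitions \<omega> s z (r j) / real (r j)) \<longlonglongrightarrow> (\<Sum>y\<in>V. p z y * e y s)"
    if "s \<in> A \<union> B" "z \<in> V" for s z
  proof -
    have "(\<lambda>j. \<Sum>y\<in>V. p z y * (occupation \<omega> y s (r j) / real (r j))) \<longlonglongrightarrow> (\<Sum>y\<in>V. p z y * e y s)"
      using that by (intro tendsto_sum tendsto_mult_left lim)
    from tendsto_add[OF sub[OF transitions_balance[OF g that]] this] show ?thesis by simp
  qed
  let ?c = "\<lambda>y n. \<Sum>l<n. of_bool (\<omega> l = y) :: real"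
  let ?u = "\<lambda>y. \<Sum>s\<in>A \<union> B. e y s"
  have c: "(\<lambda>j. ?c y (r j) / real (r j)) \<longlonglongrightarrow> ?u y" if "y \<in> V" for y
    unfolding sum_occupation[symmetric] sum_divide_distrib using that by (intro tendsto_sum lim)
  have u: "?u z = m z" if "z \<in> V" for z
  proof (rule invariant_unique[OF _ _ that])
    fix z assume z: "z \<in> V"
    have "(\<lambda>j. ?c z (r j) / real (r j)) \<longlonglongrightarrow> (\<Sum>s\<in>A \<union> B. \<Sum>y\<in>V. p z y * e y s)"
      unfolding sum_transitions[symmetric] sum_divide_distrib using z by (intro tendsto_sum trans)
    from LIMSEQ_unique[OF c[OF z] this]
    have "?u z = (\<Sum>s\<in>A \<union> B. \<Sum>y\<in>V. p z y * e y s)" .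
    also have "\<dots> = (\<Sum>y\<in>V. p z y * ?u y)"
      unfolding sum_distrib_left by (rule sum.swap)
    finally show "?u z = (\<Sum>y\<in>V. p z y * ?u y)" .
  next
    have \<omega>: "\<omega> l \<in> V" for l using g by (simp add: generic_def space_paths)
    have "(\<Sum>y\<in>V. ?c y n) = real n" for n
      using \<omega> finite_V by (subst sum.swap) (simp add: of_bool_def)
    then have tot: "(\<Sum>y\<in>V. ?c y n / real n) = 1" if "1 \<le> n" for n
      using that by (simp add: sum_divide_distrib[symmetric])
    \<comment> \<open>The frequencies add up to 1 only after a positive number of steps, and
      \<open>r j\<close> is positive as soon as j is.\<close>
    have "j \<le> r j" for j by (rule seq_suble[OF r])
    then have one: "\<forall>\<^sub>F j in sequentially. (\<Sum>y\<in>V. ?c y (r j) / real (r j)) = 1"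
      by (intro eventually_sequentiallyI[of 1] tot) (meson order_trans)
    have "(\<lambda>j. \<Sum>y\<in>V. ?c y (r j) / real (r j)) \<longlonglongrightarrow> (\<Sum>y\<in>V. ?u y)"
      by (intro tendsto_sum c)
    then show "(\<Sum>y\<in>V. ?u y) = 1"
      by (rule LIMSEQ_unique) (rule tendsto_eventually[OF one])
  qed
  have off: "e z s = 0" if "z \<in> A \<union> B" "s \<in> A \<union> B" "z \<noteq> s" for z s
  proof -
    have "z \<in> V" using that AB_sub by auto
    from lim[OF this that(2)] have "(\<lambda>j. 0) \<longlonglongrightarrow> e z s"
      using that by (simp add: occupation_AB)
    then show ?thesis by (simp add: LIMSEQ_const_iff)
  qed
  show ?thesis
    unfolding last_visit_law_def
  proof (intro ballI conjI)
    fix s z assume s: "s \<in> A \<union> B" and z: "z \<in> V - (A \<union> B)"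
    then have "(\<lambda>j. occupation \<omega> z s (r j) / real (r j)) \<longlonglongrightarrow> (\<Sum>y\<in>V. p z y * e y s)"
      using trans[of s z] by (simp add: occupation_eq_transitions)
    then show "e z s = (\<Sum>y\<in>V. p z y * e y s)"
      using s z by (intro LIMSEQ_unique[OF lim]) auto
  next
    fix s z assume s: "s \<in> A \<union> B" and z: "z \<in> A \<union> B"
    have "?u s = e s s"
      using s finite_AB off by (subst sum.remove[of _ s]) (auto intro!: sum.neutral)
    then show "e z s = (if z = s then m s else 0)"
      using off[OF z s] u[of s] s AB_sub by auto
  qed
qed

lemma occupation_bounded: "bounded (range (\<lambda>j. occupation \<omega> y s (r j) / real (r j)))"
proof -
  have "\<bar>occupation \<omega> y s n\<bar> \<le> real n" for n
  proof -
    have "norm (occupation \<omega> y s n) \<le> real (card {..<n}) * 1"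
      unfolding occupation_def by (rule sum_norm_bound) auto
    then show ?thesis by simp
  qed
  then have "norm (occupation \<omega> y s n / real n) \<le> 1" for n
    by (cases "n = 0") (simp_all add: divide_le_eq)
  then show ?thesis by (intro boundedI[of _ 1]) auto
qed

lemma occupation_subsequence:
  assumes g: "generic \<omega>" and r: "strict_mono (r :: nat \<Rightarrow> nat)"
  obtains r' e where "strict_mono r'" "last_visit_law e"
    "\<And>y s. y \<in> V \<Longrightarrow> s \<in> A \<union> B \<Longrightarrow>
      (\<lambda>j. occupation \<omega> y s (r (r' j)) / real (r (r' j))) \<longlonglongrightarrow> e y s"
proof -
  let ?X = "\<lambda>(y, s) (j :: nat). occupation \<omega> y s (r j) / real (r j)"
  have "\<exists>r'. strict_mono (r' :: nat \<Rightarrow> nat) \<and> (\<forall>i\<in>V \<times> (A \<union> B). convergent (?X i \<circ> r'))"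
  proof (rule convergent_subsequence_family)
    show "finite (V \<times> (A \<union> B))" using finite_V finite_AB by simp
    show "bounded (range (?X i))" for i using occupation_bounded by (cases i) simp
  qed
  then obtain r' :: "nat \<Rightarrow> nat" where r': "strict_mono r'" "\<And>i. i \<in> V \<times> (A \<union> B) \<Longrightarrow> convergent (?X i \<circ> r')"
    by blast
  define e where "e y s = lim (?X (y, s) \<circ> r')" for y s
  have lim: "(\<lambda>j. occupation \<omega> y s (r (r' j)) / real (r (r' j))) \<longlonglongrightarrow> e y s"
    if "y \<in> V" "s \<in> A \<union> B" for y s
    using r'(2)[of "(y, s)"] that by (simp add: e_def convergent_LIMSEQ_iff comp_def)
  moreover have "strict_mono (\<lambda>j. r (r' j))"
    using strict_mono_o[OF r r'(1)] by (simp add: comp_def)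
  ultimately have "last_visit_law e"
    using last_visit_law_of_limit[OF g] by blast
  then show ?thesis using that r'(1) lim by blast
qed

lemma occupation_tendsto:
  assumes g: "generic \<omega>" and e: "last_visit_law e" and y: "y \<in> V" and s: "s \<in> A \<union> B"
  shows "(\<lambda>n. occupation \<omega> y s n / real n) \<longlonglongrightarrow> e y s"
proof (rule tendsto_of_subsequences)
  fix r :: "nat \<Rightarrow> nat" assume r: "strict_mono r"
  from occupation_subsequence[OF g r] obtain r' e' where "strict_mono r'" "last_visit_law e'"
    "\<And>y s. y \<in> V \<Longrightarrow> s \<in> A \<union> B \<Longrightarrow>
      (\<lambda>j. occupation \<omega> y s (r (r' j)) / real (r (r' j))) \<longlonglongrightarrow> e' y s" by metis
  then show "\<exists>r'. strict_mono r' \<and> ((\<lambda>n. occupation \<omega> y s n / real n) \<circ> r \<circ> r') \<longlonglongrightarrow> e y s"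
    using last_visit_law_unique[OF e _ y s] y s by (auto simp: comp_def)
qed

lemma transitions_tendsto:
  assumes g: "generic \<omega>" and e: "last_visit_law e" and s: "s \<in> A \<union> B" and z: "z \<in> V"
  shows "(\<lambda>n. transitions \<omega> s z n / real n) \<longlonglongrightarrow> (\<Sum>y\<in>V. p z y * e y s)"
proof -
  have "(\<lambda>n. \<Sum>y\<in>V. p z y * (occupation \<omega> y s n / real n)) \<longlonglongrightarrow> (\<Sum>y\<in>V. p z y * e y s)"
    using s by (intro tendsto_sum tendsto_mult_left occupation_tendsto[OF g e])
  from tendsto_add[OF transitions_balance[OF g s z] this] show ?thesis by simp
qed

text \<open>Generic paths have probability 1, so one exists; the limit of its empirical measure is a
  solution, nonnegative because it is a limit of frequencies.\<close>

lemma last_visit_law_exists: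
  obtains e where "last_visit_law e" "\<And>y s. y \<in> V \<Longrightarrow> s \<in> A \<union> B \<Longrightarrow> 0 \<le> e y s"
proof -
  have m: "prob_vector V m" using invariant by (simp add: invariant_measure_def)
  interpret prob_space "chain V p m" by (rule prob_space_chain_init[OF m])
  obtain \<omega> where g: "generic \<omega>"
    using AE_generic[OF m] not_AE_zero_E eventually_happens ae_filter_bot by blast
  have "strict_mono (id :: nat \<Rightarrow> nat)" by (simp add: strict_mono_def)
  from occupation_subsequence[OF g this] obtain e where e: "last_visit_law e" by metis
  have "0 \<le> e y s" if "y \<in> V" "s \<in> A \<union> B" for y s
    by (rule LIMSEQ_le_const[OF occupation_tendsto[OF g e that]])
      (auto simp: occupation_def intro!: sum_nonneg divide_nonneg_nonneg)
  then show ?thesis using e that by blast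
qed

end

section \<open>Frequencies of entrances and exits\<close>

declare entry_A.simps(2) [simp del] entry_B.simps(2) [simp del]

section \<open>Cycles of a single path that visits A and B infinitely often\<close>

locale alternating_path =
  fixes A B :: "'a set" and b :: 'a and \<omega> :: "nat \<Rightarrow> 'a"
  assumes disjoint: "A \<inter> B = {}" and b: "b \<in> B"
    and inf_A: "\<exists>\<^sub>\<infinity>l. \<omega> l \<in> A" and inf_B: "\<exists>\<^sub>\<infinity>l. \<omega> l \<in> B"
begin

abbreviation "ent k \<equiv> entry_A A B \<omega> k"
abbreviation "ret k \<equiv> entry_B A B \<omega> k"
abbreviation "last_seen \<equiv> last_visit (A \<union> B) b \<omega>"

lemma entry_A_Suc: "ret k \<le> ent (Suc k) \<and> \<omega> (ent (Suc k)) \<in> A"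
proof -
  obtain l where "ret k \<le> l \<and> \<omega> l \<in> A"
    using inf_A unfolding INFM_nat_le by blast
  then show ?thesis unfolding entry_A.simps by (rule LeastI)
qed

lemma entry_B_Suc: "ent (Suc k) \<le> ret (Suc k) \<and> \<omega> (ret (Suc k)) \<in> B"
proof -
  obtain l where "ent (Suc k) \<le> l \<and> \<omega> l \<in> B"
    using inf_B unfolding INFM_nat_le by blast
  then show ?thesis unfolding entry_B.simps by (rule LeastI)
qed

lemma before_entry_A: "ret k \<le> l \<Longrightarrow> l < ent (Suc k) \<Longrightarrow> \<omega> l \<notin> A"
  using not_less_Least[of l "\<lambda>l. ret k \<le> l \<and> \<omega> l \<in> A"] by (auto simp: entry_A.simps(2))

lemma before_entry_B: "ent (Suc k) \<le> l \<Longrightarrow> l < ret (Suc k) \<Longrightarrow> \<omega> l \<notin> B"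
  using not_less_Least[of l "\<lambda>l. ent (Suc k) \<le> l \<and> \<omega> l \<in> B"] by (auto simp: entry_B.simps(2))

lemma ent_less_ret: "ent (Suc k) < ret (Suc k)"
proof -
  have "ent (Suc k) \<noteq> ret (Suc k)"
    using entry_A_Suc[of k] entry_B_Suc[of k] disjoint by auto
  then show ?thesis using entry_B_Suc[of k] by simp
qed

text \<open>The cycles \<open>{cycle_start k..<cycle_start (Suc k)}\<close>, each ending with an entrance to \<open>B\<close>,
  partition the time axis.\<close>

definition cycle_start :: "nat \<Rightarrow> nat" where
  "cycle_start k = (if k = 0 then 0 else Suc (ret k))"

lemma cycle_Suc: "cycle_start (Suc k) = Suc (ret (Suc k))"
  by (simp add: cycle_start_def)

lemma ret_le_cycle: "ret k \<le> cycle_start k"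
  by (cases k) (simp_all add: cycle_start_def)

lemma cycle_le_ent: "cycle_start k \<le> ent (Suc k)"
proof (cases k)
  case (Suc j)
  have "ret k \<noteq> ent (Suc k)"
    using entry_A_Suc[of k] entry_B_Suc[of j] disjoint Suc by auto
  then show ?thesis using entry_A_Suc[of k] Suc by (simp add: cycle_start_def)
qed (simp add: cycle_start_def)

lemma strict_mono_cycle: "strict_mono cycle_start"
  unfolding strict_mono_Suc_iff
proof
  fix k
  show "cycle_start k < cycle_start (Suc k)"
    using cycle_le_ent[of k] ent_less_ret[of k] by (simp add: cycle_Suc)
qed

lemma last_AB_cycle: "last_seen (cycle_start k) \<in> B"
  using entry_B_Suc b by (cases k) (auto simp: cycle_start_def)

text \<open>The range includes the entrance time, because \<open>last_visit\<close> ignores the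
  present state: on arrival in A the recorded state is still in B.\<close>

lemma last_AB_before_ent:
  assumes "cycle_start k \<le> l" "l \<le> ent (Suc k)"
  shows "last_seen l \<in> B"
  using assms
proof (induction l rule: dec_induct)
  case base
  show ?case by (rule last_AB_cycle)
next
  case (step l)
  then show ?case
    using before_entry_A[of k l] ret_le_cycle[of k] by auto
qed

text \<open>Likewise, at the return time the path is already in B while the recorded state is still
  in A.\<close>

lemma last_AB_after_ent:
  assumes "Suc (ent (Suc k)) \<le> l" "l \<le> ret (Suc k)"
  shows "last_seen l \<in> A"
  using assms
proof (induction l rule: dec_induct)
  case base
  show ?case using entry_A_Suc[of k] by auto
next
  case (step l)
  then show ?case
    using before_entry_B[of k l] by auto
qed

text \<open>After the last exit neither A nor B is visited until the return. So the exit state,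
  which is known to be the last one only in hindsight, is on record when B is entered.\<close>

lemma last_AB_ret: "last_seen (ret (Suc k)) = \<omega> (exit_A A B \<omega> (Suc k))"
  and exit_A_in: "\<omega> (exit_A A B \<omega> (Suc k)) \<in> A"
proof -
  let ?S = "{l. \<omega> l \<in> A \<and> ent (Suc k) \<le> l \<and> l < ret (Suc k)}"
  let ?\<sigma> = "exit_A A B \<omega> (Suc k)"
  have fin: "finite ?S" by simp
  have "ent (Suc k) \<in> ?S" using entry_A_Suc[of k] ent_less_ret[of k] by simp
  then have \<sigma>: "?\<sigma> \<in> ?S"
    unfolding exit_A_def using Max_in[OF fin] by blast
  then show "\<omega> ?\<sigma> \<in> A" by simp
  have after: "\<omega> l \<notin> A" if "?\<sigma> < l" "l < ret (Suc k)" for l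
  proof
    assume "\<omega> l \<in> A"
    then have "l \<in> ?S" using that \<sigma> by simp
    then have "l \<le> ?\<sigma>" unfolding exit_A_def using Max_ge[OF fin] by blast
    then show False using that by simp
  qed
  have "last_seen l = \<omega> ?\<sigma>" if "Suc ?\<sigma> \<le> l" "l \<le> ret (Suc k)" for l
    using that
  proof (induction l rule: dec_induct)
    case base
    show ?case using \<sigma> by simp
  next
    case (step l)
    then show ?case
      using after[of l] before_entry_B[of k l] \<sigma> by auto
  qed
  then show "last_seen (ret (Suc k)) = \<omega> ?\<sigma>" using \<sigma> by simp
qed

lemma sum_cycles: "(\<Sum>l<cycle_start K. f l) = (\<Sum>k<K. \<Sum>l\<in>{cycle_start k..<cycle_start (Suc k)}. f l :: real)"
proof (induction K)
  case (Suc K)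
  have "cycle_start K \<le> cycle_start (Suc K)" using strict_mono_cycle by (simp add: strict_mono_less_eq)
  then have "(\<Sum>l<cycle_start (Suc K). f l) = (\<Sum>l<cycle_start K. f l) + (\<Sum>l\<in>{cycle_start K..<cycle_start (Suc K)}. f l)"
    by (metis atLeast0LessThan le0 sum.atLeastLessThan_concat)
  then show ?case using Suc by simp
qed (simp add: cycle_start_def)

text \<open>Common scheme of the two counts below: each cycle contributes at exactly one time. The
  shift \<open>k - 1\<close> reflects that segments are numbered from 1 and cycles from 0.\<close>

lemma sum_cycles_single:
  assumes "\<And>k. t k \<in> {cycle_start k..<cycle_start (Suc k)}"
    and "\<And>k l. l \<in> {cycle_start k..<cycle_start (Suc k)} \<Longrightarrow> f l = (if l = t k then g k else (0::real))"
  shows "(\<Sum>l<cycle_start K. f l) = (\<Sum>k=1..K. g (k - 1))"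
proof -
  have "(\<Sum>l\<in>{cycle_start k..<cycle_start (Suc k)}. f l) = g k" for k
  proof -
    have "(\<Sum>l\<in>{cycle_start k..<cycle_start (Suc k)}. f l) =
        (\<Sum>l\<in>{cycle_start k..<cycle_start (Suc k)}. if l = t k then g k else 0)"
      by (rule sum.cong[OF refl assms(2)])
    then show ?thesis using assms(1)[of k] by simp
  qed
  then have "(\<Sum>l<cycle_start K. f l) = (\<Sum>k<K. g k)" by (simp only: sum_cycles)
  also have "\<dots> = (\<Sum>k=1..K. g (k - 1))"
    by (rule sum.reindex_bij_witness[of _ "\<lambda>k. k - 1" Suc]) auto
  finally show ?thesis .
qed

lemma ent_in_cycle: "ent (Suc k) \<in> {cycle_start k..<cycle_start (Suc k)}"
  and ret_in_cycle: "ret (Suc k) \<in> {cycle_start k..<cycle_start (Suc k)}"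
  using cycle_le_ent[of k] ent_less_ret[of k] by (auto simp: cycle_Suc)

text \<open>Within a cycle, A is not visited before the entrance, and after it the recorded state is
  in A. So only the entrance is counted.\<close>

lemma count_entries:
  assumes x: "x \<in> A"
  shows "(\<Sum>l<cycle_start K. of_bool (last_seen l \<in> B) * of_bool (\<omega> l = x)) =
    (\<Sum>k=1..K. indicator {x} (\<omega> (ent k)) :: real)"
proof -
  have "(\<Sum>l<cycle_start K. of_bool (last_seen l \<in> B) * of_bool (\<omega> l = x)) =
    (\<Sum>k=1..K. of_bool (\<omega> (ent (Suc (k - 1))) = x) :: real)"
  proof (rule sum_cycles_single[OF ent_in_cycle])
    fix k l assume l: "l \<in> {cycle_start k..<cycle_start (Suc k)}"
    show "of_bool (last_seen l \<in> B) * of_bool (\<omega> l = x) =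
      (if l = ent (Suc k) then of_bool (\<omega> (ent (Suc k)) = x) else (0::real))"
    proof (cases l "ent (Suc k)" rule: linorder_cases)
      case less
      then have "\<omega> l \<noteq> x"
        using before_entry_A[of k l] ret_le_cycle[of k] l x by auto
      then show ?thesis using less by simp
    next
      case equal
      then show ?thesis using last_AB_before_ent[of k l] l by simp
    next
      case greater
      then have "last_seen l \<in> A" using l by (intro last_AB_after_ent[of k]) (auto simp: cycle_Suc)
      then show ?thesis using greater disjoint by auto
    qed
  qed
  also have "\<dots> = (\<Sum>k=1..K. indicator {x} (\<omega> (ent k)))"
    by (intro sum.cong) (auto simp: indicator_def)
  finally show ?thesis .
qed

text \<open>Up to the entrance to A the recorded state is in B and so differs from x; from there to
  the return B is not visited. Only the return is counted, with the exit state on record.\<close>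

lemma count_exits:
  assumes x: "x \<in> A"
  shows "(\<Sum>l<cycle_start K. of_bool (last_seen l = x) * of_bool (\<omega> l \<in> B)) =
    (\<Sum>k=1..K. indicator {x} (\<omega> (exit_A A B \<omega> k)) :: real)"
proof -
  have "(\<Sum>l<cycle_start K. of_bool (last_seen l = x) * of_bool (\<omega> l \<in> B)) =
    (\<Sum>k=1..K. of_bool (\<omega> (exit_A A B \<omega> (Suc (k - 1))) = x) :: real)"
  proof (rule sum_cycles_single[OF ret_in_cycle])
    fix k l assume l: "l \<in> {cycle_start k..<cycle_start (Suc k)}"
    consider "l \<le> ent (Suc k)" | "ent (Suc k) < l" "l < ret (Suc k)" | "l = ret (Suc k)"
      using l by (force simp: cycle_Suc)
    then show "of_bool (last_seen l = x) * of_bool (\<omega> l \<in> B) =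
      (if l = ret (Suc k) then of_bool (\<omega> (exit_A A B \<omega> (Suc k)) = x) else (0::real))"
    proof cases
      case 1
      then have "last_seen l \<noteq> x" "l \<noteq> ret (Suc k)"
        using last_AB_before_ent[of k l] l x disjoint ent_less_ret[of k] by auto
      then show ?thesis by simp
    next
      case 2
      then show ?thesis using before_entry_B[of k l] by simp
    next
      case 3
      then show ?thesis
        using last_AB_ret[of k] entry_B_Suc[of k] by simp
    qed
  qed
  also have "\<dots> = (\<Sum>k=1..K. indicator {x} (\<omega> (exit_A A B \<omega> k)))"
    by (intro sum.cong) (auto simp: indicator_def)
  finally show ?thesis .
qed

end

section \<open>The constant \<open>Z\<close> and the limiting frequencies\<close>

context reactive_chain
begin

abbreviation Z :: real where
  "Z \<equiv> \<Sum>x\<in>A. \<Sum>y\<in>V. m y * (1 - qm y) * p x y"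

lemma sum_V_split:
  "(\<Sum>y\<in>V. f y) = (\<Sum>y\<in>V - (A \<union> B). f y) + (\<Sum>y\<in>A. f y) + (\<Sum>y\<in>B. f y :: real)"
  using sum.subset_diff[OF AB_sub finite_V, of f] sum.union_disjoint[OF finite_A finite_B disjoint, of f]
  by simp

lemma qm_A: "x \<in> A \<Longrightarrow> qm x = 1" and qm_B: "x \<in> B \<Longrightarrow> qm x = 0"
  using backward by (auto simp: backward_committor_def)

text \<open>Multiplying the backward equation by m turns it into a balance for \<open>m qm\<close>
  under p, so the reversed chain itself never has to be run.\<close>

lemma qm_step: "z \<in> V - (A \<union> B) \<Longrightarrow> m z * qm z = (\<Sum>y\<in>V. p z y * (m y * qm y))"
proof -
  assume z: "z \<in> V - (A \<union> B)"
  then have "qm z = (\<Sum>y\<in>V. reversed p m y z * qm y)"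
    using backward by (simp add: backward_committor_def)
  also have "\<dots> = (\<Sum>y\<in>V. p z y * (m y * qm y)) / m z"
    by (simp add: reversed_def sum_divide_distrib ac_simps)
  finally show ?thesis using m_pos[of z] z by (simp add: field_simps)
qed

text \<open>Summing over s in S preserves the harmonic equation and gives the boundary values m on S
  and 0 on the rest of A \<union> B. For S = A these are the data of \<open>m qm\<close>, for S = A
  \<union> B those of m.\<close>

lemma last_visit_law_sum:
  assumes e: "last_visit_law e" and y: "y \<in> V"
  shows "(\<Sum>s\<in>A. e y s) = m y * qm y" and "(\<Sum>s\<in>B. e y s) = m y * (1 - qm y)"
proof -
  have harm: "(\<Sum>s\<in>S. e z s) = (\<Sum>y\<in>V. p z y * (\<Sum>s\<in>S. e y s))"
    if "S \<subseteq> A \<union> B" "z \<in> V - (A \<union> B)" for S z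
  proof -
    have "(\<Sum>s\<in>S. e z s) = (\<Sum>s\<in>S. \<Sum>y\<in>V. p z y * e y s)"
      using that e by (intro sum.cong) (auto simp: last_visit_law_def)
    then show ?thesis unfolding sum_distrib_left by (subst (asm) sum.swap)
  qed
  have bdry: "(\<Sum>s\<in>S. e z s) = (if z \<in> S then m z else 0)"
    if "S \<subseteq> A \<union> B" "z \<in> A \<union> B" for S z
  proof -
    have "(\<Sum>s\<in>S. e z s) = (\<Sum>s\<in>S. if s = z then m z else 0)"
      using that e by (intro sum.cong) (auto simp: last_visit_law_def)
    then show ?thesis using that finite_AB by (simp add: finite_subset)
  qed
  show "(\<Sum>s\<in>A. e y s) = m y * qm y"
    by (rule dirichlet_unique[OF AB_sub AB_ne _ _ _ y])
      (use harm[of A] bdry[of A] qm_A qm_B qm_step disjoint in auto)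
  moreover have "(\<Sum>s\<in>A \<union> B. e y s) = m y"
    by (rule dirichlet_unique[OF AB_sub AB_ne _ _ _ y])
      (use harm[of "A \<union> B"] bdry[of "A \<union> B"] m_invariant in auto)
  ultimately show "(\<Sum>s\<in>B. e y s) = m y * (1 - qm y)"
    using sum.union_disjoint[OF finite_A finite_B disjoint, of "e y"] by (simp add: algebra_simps)
qed

text \<open>The equations for \<open>qm\<close> do not display a sign; it is inherited from the
  nonnegative solution found by counting.\<close>

lemma mqm_nonneg: "y \<in> V \<Longrightarrow> 0 \<le> m y * qm y" and m1qm_nonneg: "y \<in> V \<Longrightarrow> 0 \<le> m y * (1 - qm y)"
proof -
  obtain e where e: "last_visit_law e" "\<And>y s. y \<in> V \<Longrightarrow> s \<in> A \<union> B \<Longrightarrow> 0 \<le> e y s"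
    using last_visit_law_exists by blast
  assume y: "y \<in> V"
  show "0 \<le> m y * qm y" "0 \<le> m y * (1 - qm y)"
    unfolding last_visit_law_sum[OF e(1) y, symmetric] using y by (auto intro!: sum_nonneg e(2))
qed

text \<open>Mass balance for \<open>m qm\<close>: one step of p keeps the total mass, changes
  nothing off A \<union> B and loses \<open>Z\<close> on A. Since \<open>m qm\<close> vanishes on B,
  the inflow there is \<open>Z\<close>.\<close>

lemma Z_eq: "Z = (\<Sum>x\<in>B. \<Sum>y\<in>V. m y * qm y * p x y)"
proof -
  let ?a = "\<lambda>y. m y * qm y"
  let ?T = "\<lambda>z. \<Sum>y\<in>V. p z y * ?a y"
  have A: "(\<Sum>x\<in>A. ?T x) = (\<Sum>x\<in>A. ?a x) - Z"
  proof -
    have "?T x = ?a x - (\<Sum>y\<in>V. m y * (1 - qm y) * p x y)" if "x \<in> A" for x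
    proof -
      have "m x = (\<Sum>y\<in>V. p x y * m y)" using m_invariant[of x] that A_sub by auto
      then show ?thesis
        using qm_A[OF that] by (simp add: sum_subtractf[symmetric] algebra_simps)
    qed
    then show ?thesis by (simp add: sum_subtractf)
  qed
  have "(\<Sum>z\<in>V. ?T z) = (\<Sum>z\<in>V. ?a z)" by (rule sum_transition)
  moreover have "(\<Sum>z\<in>V - (A \<union> B). ?T z) = (\<Sum>z\<in>V - (A \<union> B). ?a z)"
    by (intro sum.cong qm_step[symmetric]) auto
  moreover have "(\<Sum>z\<in>B. ?a z) = 0" using qm_B by simp
  ultimately show ?thesis
    unfolding sum_V_split[of ?T] sum_V_split[of ?a] A by (simp add: ac_simps)
qed

text \<open>If \<open>Z\<close> vanished, the subinvariant measure \<open>m (1 - qm)\<close>, which charges \<open>B\<close>,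
  would not charge \<open>A\<close>.\<close>

lemma Z_pos: "0 < Z"
proof (rule ccontr)
  let ?u = "\<lambda>y. m y * (1 - qm y)"
  have nn: "0 \<le> (\<Sum>y\<in>V. ?u y * p x y)" if "x \<in> V" for x
    using that by (intro sum_nonneg mult_nonneg_nonneg m1qm_nonneg p_nonneg)
  assume "\<not> 0 < Z"
  moreover have "0 \<le> Z" by (rule sum_nonneg) (use nn A_sub in auto)
  ultimately have "Z = 0" by simp
  then have zero: "(\<Sum>y\<in>V. ?u y * p x y) = 0" if "x \<in> A" for x
    using that nn A_sub finite_A by (subst (asm) sum_nonneg_eq_0_iff) auto
  obtain x where x: "x \<in> A" using A_ne by auto
  have bV: "b \<in> V" using b B_sub by auto
  have "0 < ?u x"
  proof (rule superinvariant_positive[of ?u b])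
    fix z assume z: "z \<in> V"
    show "0 \<le> ?u z" by (rule m1qm_nonneg[OF z])
    have m: "m z = (\<Sum>y\<in>V. p z y * m y)" by (rule m_invariant[OF z, symmetric])
    consider "z \<in> A" | "z \<in> B" | "z \<in> V - (A \<union> B)" using z by auto
    then show "(\<Sum>y\<in>V. p z y * ?u y) \<le> ?u z"
    proof cases
      case 1
      then show ?thesis using zero[of z] qm_A[of z] by (simp add: ac_simps)
    next
      case 2
      have "(\<Sum>y\<in>V. p z y * ?u y) \<le> (\<Sum>y\<in>V. p z y * m y)"
        using z mqm_nonneg by (intro sum_mono mult_left_mono p_nonneg) (auto simp: algebra_simps)
      then show ?thesis using m qm_B[OF 2] by simp
    next
      case 3
      have "?u z = (\<Sum>y\<in>V. p z y * m y) - (\<Sum>y\<in>V. p z y * (m y * qm y))"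
        using m qm_step[OF 3] by (simp add: algebra_simps)
      then show ?thesis by (simp add: sum_subtractf[symmetric] algebra_simps)
    qed
  next
    show "0 < ?u b" using m_pos[OF bV] qm_B[OF b] by simp
  qed (use x A_sub bV in auto)
  then show False using qm_A[OF x] by simp
qed

lemma frequency_tendsto:
  assumes g: "generic \<omega>" and y: "y \<in> V"
  shows "(\<lambda>n. (\<Sum>l<n. of_bool (\<omega> l = y)) / real n) \<longlonglongrightarrow> m y"
proof -
  obtain e where e: "last_visit_law e" by (rule last_visit_law_exists)
  have "(\<lambda>n. (\<Sum>l<n. of_bool (\<omega> l = y)) / real n) \<longlonglongrightarrow> (\<Sum>s\<in>A \<union> B. e y s)"
    unfolding sum_occupation[symmetric] sum_divide_distrib
    by (intro tendsto_sum occupation_tendsto[OF g e y])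
  also have "(\<Sum>s\<in>A \<union> B. e y s) = m y"
    using last_visit_law_sum[OF e y] sum.union_disjoint[OF finite_A finite_B disjoint, of "e y"]
    by (simp add: algebra_simps)
  finally show ?thesis .
qed

text \<open>A state visited only finitely often would have frequency 0, whereas \<open>m y\<close>
  is positive.\<close>

lemma generic_infinitely_often:
  assumes g: "generic \<omega>" and y: "y \<in> V"
  shows "\<exists>\<^sub>\<infinity>l. \<omega> l = y"
proof (rule ccontr)
  assume "\<not> (\<exists>\<^sub>\<infinity>l. \<omega> l = y)"
  then have fin: "finite {l. \<omega> l = y}" by (simp add: frequently_cofinite)
  have "\<bar>\<Sum>l<n. of_bool (\<omega> l = y)\<bar> \<le> real (card {l. \<omega> l = y})" for n
    using card_mono[OF fin, of "{..<n} \<inter> {l. \<omega> l = y}"] by simp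
  from bounded_over_n_tendsto_zero[OF this] frequency_tendsto[OF g y]
  have "m y = 0" by (rule LIMSEQ_unique[symmetric])
  then show False using m_pos[OF y] by simp
qed

lemma alternating_path:
  assumes "generic \<omega>"
  shows "alternating_path A B b \<omega>"
proof
  obtain x where x: "x \<in> A" using A_ne by auto
  show "\<exists>\<^sub>\<infinity>l. \<omega> l \<in> A"
    by (rule INFM_mono[OF generic_infinitely_often[OF assms, of x]]) (use x A_sub in auto)
  show "\<exists>\<^sub>\<infinity>l. \<omega> l \<in> B"
    by (rule INFM_mono[OF generic_infinitely_often[OF assms, of b]]) (use b B_sub in auto)
qed (use disjoint b in auto)

text \<open>These arrivals are the \<open>transitions\<close> to x with last state in B; their
  limits add up to one step of p applied to \<open>m (1 - qm)\<close>.\<close>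

lemma entries_tendsto:
  assumes g: "generic \<omega>" and x: "x \<in> A"
  shows "(\<lambda>n. (\<Sum>l<n. of_bool (last_AB \<omega> l \<in> B) * of_bool (\<omega> l = x)) / real n)
    \<longlonglongrightarrow> (\<Sum>y\<in>V. m y * (1 - qm y) * p x y)"
proof -
  obtain e where e: "last_visit_law e" by (rule last_visit_law_exists)
  have "(\<Sum>s\<in>B. of_bool (last_AB \<omega> l = s) * c) = of_bool (last_AB \<omega> l \<in> B) * (c :: real)" for l c
    using finite_B by (simp add: of_bool_def if_distrib[of "\<lambda>t. t * c"] cong: if_cong)
  then have eq: "(\<Sum>l<n. of_bool (last_AB \<omega> l \<in> B) * of_bool (\<omega> l = x)) = (\<Sum>s\<in>B. transitions \<omega> s x n)" for n
    unfolding transitions_def by (subst sum.swap) simp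
  have "(\<lambda>n. (\<Sum>s\<in>B. transitions \<omega> s x n / real n)) \<longlonglongrightarrow> (\<Sum>s\<in>B. \<Sum>y\<in>V. p x y * e y s)"
    using x A_sub by (intro tendsto_sum transitions_tendsto[OF g e]) auto
  also have "(\<Sum>s\<in>B. \<Sum>y\<in>V. p x y * e y s) = (\<Sum>y\<in>V. p x y * (\<Sum>s\<in>B. e y s))"
    unfolding sum_distrib_left by (rule sum.swap)
  also have "\<dots> = (\<Sum>y\<in>V. m y * (1 - qm y) * p x y)"
    by (simp add: last_visit_law_sum[OF e] mult.commute)
  finally show ?thesis by (simp add: eq sum_divide_distrib)
qed

text \<open>Summing the balance of \<open>e\<close> against a function that is harmonic off \<open>A \<union> B\<close> moves
  the flux into \<open>B\<close> back to the starting point \<open>x\<close>.\<close>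

lemma exit_flux:
  assumes e: "last_visit_law e" and x: "x \<in> A"
    and h: "\<And>y. y \<in> V - (A \<union> B) \<Longrightarrow> h y = (\<Sum>z\<in>V. p z y * h z)"
      "\<And>y. y \<in> A \<Longrightarrow> h y = 0" "\<And>y. y \<in> B \<Longrightarrow> h y = 1"
  shows "(\<Sum>z\<in>B. \<Sum>y\<in>V. p z y * e y x) = m x * (\<Sum>z\<in>V. p z x * h z)"
proof -
  let ?T = "\<lambda>z. \<Sum>y\<in>V. p z y * e y x" and ?H = "\<lambda>y. \<Sum>z\<in>V. p z y * h z"
  have "(\<Sum>z\<in>V. h z * ?T z) = (\<Sum>y\<in>V. e y x * ?H y)"
    unfolding sum_distrib_left by (subst sum.swap) (simp add: ac_simps)
  moreover have "(\<Sum>z\<in>V - (A \<union> B). h z * ?T z) = (\<Sum>y\<in>V - (A \<union> B). e y x * ?H y)"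
    using e x h(1) by (intro sum.cong) (auto simp: last_visit_law_def)
  moreover have "(\<Sum>z\<in>A. h z * ?T z) = 0" "(\<Sum>z\<in>B. h z * ?T z) = (\<Sum>z\<in>B. ?T z)"
    using h by auto
  moreover have "(\<Sum>y\<in>A. e y x * ?H y) = (\<Sum>y\<in>A. if y = x then m x * ?H x else 0)"
    using e x by (intro sum.cong) (auto simp: last_visit_law_def)
  then have "(\<Sum>y\<in>A. e y x * ?H y) = m x * ?H x"
    using x finite_A by simp
  moreover have "(\<Sum>y\<in>B. e y x * ?H y) = 0"
    using e x disjoint by (intro sum.neutral) (auto simp: last_visit_law_def)
  ultimately show ?thesis
    unfolding sum_V_split[of "\<lambda>z. h z * ?T z"] sum_V_split[of "\<lambda>y. e y x * ?H y"] by simp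
qed

text \<open>The events counted are arrivals in B with x on record, whose rate
  \<open>exit_flux\<close> evaluates. The committor is represented by h, through its equations
  alone.\<close>

lemma exits_tendsto:
  assumes g: "generic \<omega>" and x: "x \<in> A"
    and h: "\<And>y. y \<in> V - (A \<union> B) \<Longrightarrow> h y = (\<Sum>z\<in>V. p z y * h z)"
      "\<And>y. y \<in> A \<Longrightarrow> h y = 0" "\<And>y. y \<in> B \<Longrightarrow> h y = 1"
  shows "(\<lambda>n. (\<Sum>l<n. of_bool (last_AB \<omega> l = x) * of_bool (\<omega> l \<in> B)) / real n)
    \<longlonglongrightarrow> m x * (\<Sum>z\<in>V. p z x * h z)"
proof -
  obtain e where e: "last_visit_law e" by (rule last_visit_law_exists)
  have "(\<Sum>z\<in>B. c * of_bool (\<omega> l = z)) = (c :: real) * of_bool (\<omega> l \<in> B)" for l c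
    using finite_B by (simp add: of_bool_def if_distrib[of "\<lambda>t. c * t"] cong: if_cong)
  then have eq: "(\<Sum>l<n. of_bool (last_AB \<omega> l = x) * of_bool (\<omega> l \<in> B)) = (\<Sum>z\<in>B. transitions \<omega> x z n)" for n
    unfolding transitions_def by (subst sum.swap) simp
  have "(\<lambda>n. (\<Sum>z\<in>B. transitions \<omega> x z n / real n)) \<longlonglongrightarrow> (\<Sum>z\<in>B. \<Sum>y\<in>V. p z y * e y x)"
    using x B_sub by (intro tendsto_sum transitions_tendsto[OF g e]) auto
  also have "(\<Sum>z\<in>B. \<Sum>y\<in>V. p z y * e y x) = m x * (\<Sum>z\<in>V. p z x * h z)"
    by (rule exit_flux[OF e x h])
  finally show ?thesis by (simp add: eq sum_divide_distrib)
qed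

text \<open>Frequencies per cycle are frequencies per unit of time divided by \<open>Z\<close>, the number of
  cycles per unit of time.\<close>

lemma per_cycle_tendsto:
  assumes g: "generic \<omega>" and F: "(\<lambda>n. F n / real n) \<longlonglongrightarrow> w"
  shows "(\<lambda>K. F (alternating_path.cycle_start A B \<omega> K) / real K) \<longlonglongrightarrow> w / Z"
proof -
  interpret alternating_path A B b \<omega> by (rule alternating_path[OF g])
  have sub: "(\<lambda>K. f (cycle_start K)) \<longlonglongrightarrow> l" if "f \<longlonglongrightarrow> l" for f :: "nat \<Rightarrow> real" and l
    using LIMSEQ_subseq_LIMSEQ[OF that strict_mono_cycle] by (simp add: comp_def)
  have "(\<Sum>x\<in>A. \<Sum>k=1..K. indicator {x} (\<omega> (entry_A A B \<omega> k))) = real K" for K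
  proof -
    have "(\<Sum>x\<in>A. indicator {x} (\<omega> (entry_A A B \<omega> k))) = (1 :: real)" if "k \<in> {1..K}" for k
    proof -
      have "\<omega> (entry_A A B \<omega> k) \<in> A" using entry_A_Suc[of "k - 1"] that by simp
      then show ?thesis using finite_A by (simp add: indicator_def of_bool_def)
    qed
    then show ?thesis by (subst sum.swap) simp
  qed
  then have "real K / real (cycle_start K) =
    (\<Sum>x\<in>A. (\<Sum>l<cycle_start K. of_bool (last_AB \<omega> l \<in> B) * of_bool (\<omega> l = x)) / real (cycle_start K))" for K
    by (simp only: sum_divide_distrib[symmetric] count_entries cong: sum.cong)
  moreover have "(\<lambda>K. \<Sum>x\<in>A. (\<Sum>l<cycle_start K. of_bool (last_AB \<omega> l \<in> B) * of_bool (\<omega> l = x)) / real (cycle_start K))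
      \<longlonglongrightarrow> Z"
    by (intro tendsto_sum sub entries_tendsto[OF g])
  ultimately have "(\<lambda>K. real K / real (cycle_start K)) \<longlonglongrightarrow> Z" by simp
  with sub[OF F] have "(\<lambda>K. (F (cycle_start K) / real (cycle_start K)) / (real K / real (cycle_start K))) \<longlonglongrightarrow> w / Z"
    using Z_pos by (intro tendsto_divide) auto
  moreover have "\<forall>\<^sub>F K in sequentially.
      (F (cycle_start K) / real (cycle_start K)) / (real K / real (cycle_start K)) = F (cycle_start K) / real K"
  proof (rule eventually_sequentiallyI[of 1])
    fix K :: nat assume "1 \<le> K"
    then have "0 < cycle_start K" by (simp add: cycle_start_def)
    then show "(F (cycle_start K) / real (cycle_start K)) / (real K / real (cycle_start K)) = F (cycle_start K) / real K"
      by simp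
  qed
  ultimately show ?thesis by (rule Lim_transform_eventually)
qed

lemma prob_vector_m: "prob_vector V m"
  using invariant by (simp add: invariant_measure_def)

lemma initial_distributionI:
  assumes "\<And>\<omega> x. generic \<omega> \<Longrightarrow>
    (\<lambda>K. (\<Sum>k=1..K. indicator {x} (\<omega> (start A B \<omega> k))) / real K) \<longlonglongrightarrow> \<mu> x"
  shows "initial_distribution start V p m A B \<mu>"
  unfolding initial_distribution_def using AE_generic[OF prob_vector_m]
proof eventually_elim
  case (elim \<omega>)
  then interpret alternating_path A B b \<omega> by (rule alternating_path)
  show ?case using inf_A inf_B assms[OF elim] by blast
qed

lemma nonreactive_initial_distribution:
  "nonreactive_initial_distribution V p m A B
    (\<lambda>x. if x \<in> A then (\<Sum>y\<in>V. m y * (1 - qm y) * p x y) / Z else 0)"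
proof (rule initial_distributionI)
  fix \<omega> x assume g: "generic \<omega>"
  interpret alternating_path A B b \<omega> by (rule alternating_path[OF g])
  show "(\<lambda>K. (\<Sum>k=1..K. indicator {x} (\<omega> (entry_A A B \<omega> k))) / real K) \<longlonglongrightarrow>
    (if x \<in> A then (\<Sum>y\<in>V. m y * (1 - qm y) * p x y) / Z else 0)"
  proof (cases "x \<in> A")
    case True
    then show ?thesis
      using per_cycle_tendsto[OF g entries_tendsto[OF g True]] by (simp only: count_entries if_True)
  next
    case False
    have eq: "(\<Sum>k=1..K. indicator {x} (\<omega> (entry_A A B \<omega> k))) = (0::real)" for K
    proof (rule sum.neutral, rule ballI)
      fix k assume "k \<in> {1..K}"
      then show "indicator {x} (\<omega> (entry_A A B \<omega> k)) = (0::real)"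
        using entry_A_Suc[of "k - 1"] False by (auto simp: indicator_def)
    qed
    show ?thesis using False by (simp only: eq if_False) simp
  qed
qed

lemma reactive_initial_distribution:
  assumes h: "\<And>y. y \<in> V - (A \<union> B) \<Longrightarrow> h y = (\<Sum>z\<in>V. p z y * h z)"
      "\<And>y. y \<in> A \<Longrightarrow> h y = 0" "\<And>y. y \<in> B \<Longrightarrow> h y = 1"
  shows "reactive_initial_distribution V p m A B
    (\<lambda>x. if x \<in> A then m x * (\<Sum>z\<in>V. p z x * h z) / Z else 0)"
proof (rule initial_distributionI)
  fix \<omega> x assume g: "generic \<omega>"
  interpret alternating_path A B b \<omega> by (rule alternating_path[OF g])
  show "(\<lambda>K. (\<Sum>k=1..K. indicator {x} (\<omega> (exit_A A B \<omega> k))) / real K) \<longlonglongrightarrow>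
    (if x \<in> A then m x * (\<Sum>z\<in>V. p z x * h z) / Z else 0)"
  proof (cases "x \<in> A")
    case True
    then show ?thesis
      using per_cycle_tendsto[OF g exits_tendsto[OF g True h]] by (simp only: count_exits if_True)
  next
    case False
    have eq: "(\<Sum>k=1..K. indicator {x} (\<omega> (exit_A A B \<omega> k))) = (0::real)" for K
    proof (rule sum.neutral, rule ballI)
      fix k assume "k \<in> {1..K}"
      then show "indicator {x} (\<omega> (exit_A A B \<omega> k)) = (0::real)"
        using exit_A_in[of "k - 1"] False by (auto simp: indicator_def)
    qed
    show ?thesis using False by (simp only: eq if_False) simp
  qed
qed

end

section \<open>Numbers of visits\<close>

lemma le_hitting_time_iff: "enat l \<le> hitting_time S \<omega> \<longleftrightarrow> (\<forall>i<l. \<omega> i \<notin> S)"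
  unfolding hitting_time_def le_Inf_iff by (auto simp: not_less[symmetric])

lemma less_hitting_time_iff: "enat l < hitting_time S \<omega> \<longleftrightarrow> (\<forall>i\<le>l. \<omega> i \<notin> S)"
  unfolding Suc_ile_eq[symmetric] le_hitting_time_iff less_Suc_eq_le ..

lemma hitting_time_less_iff:
  "hitting_time S \<omega> < hitting_time T \<omega> \<longleftrightarrow> (\<exists>l. \<omega> l \<in> S \<and> (\<forall>i\<le>l. \<omega> i \<notin> T))"
  unfolding hitting_time_def[of S] Inf_less_iff by (auto simp: less_hitting_time_iff)

text \<open>The hypotheses matter at l = 0: the left side is then true, and k = 0 is the witness on
  the right.\<close>

lemma le_last_exit_iff:
  assumes "\<omega> 0 \<in> A" "\<omega> 0 \<notin> B"
  shows "enat l \<le> last_exit A B \<omega> \<longleftrightarrow> (\<exists>k\<ge>l. \<omega> k \<in> A \<and> (\<forall>i\<le>k. \<omega> i \<notin> B))"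
proof (cases l)
  case 0
  then show ?thesis using assms by (auto simp: zero_enat_def[symmetric] intro!: exI[of _ 0])
next
  case (Suc j)
  \<comment> \<open>Replacing \<open>enat (Suc j) \<le> t\<close> by \<open>enat j < t\<close>
    allows the supremum to be tested on its members, also when it is infinite.\<close>
  show ?thesis
    unfolding Suc Suc_ile_eq last_exit_def less_Sup_iff by (auto simp: less_hitting_time_iff Suc_le_eq)
qed

lemma last_exit_le_iff:
  "last_exit A B \<omega> \<le> enat l \<longleftrightarrow> (\<forall>k>l. \<omega> k \<in> A \<longrightarrow> (\<exists>i\<le>k. \<omega> i \<in> B))"
proof -
  have "last_exit A B \<omega> \<le> enat l \<longleftrightarrow> (\<forall>k. \<omega> k \<in> A \<longrightarrow> (\<forall>i\<le>k. \<omega> i \<notin> B) \<longrightarrow> k \<le> l)"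
    unfolding last_exit_def Sup_le_iff by (auto simp: less_hitting_time_iff)
  also have "\<dots> \<longleftrightarrow> (\<forall>k>l. \<omega> k \<in> A \<longrightarrow> (\<exists>i\<le>k. \<omega> i \<in> B))"
    by (meson not_le)
  finally show ?thesis .
qed

context finite_chain
begin

lemma pred_coord [measurable]: "Measurable.pred paths (\<lambda>\<omega>. \<omega> i \<in> S)"
  by (rule measurable_compose[OF measurable_coord]) simp

text \<open>The events \<open>Q l\<close>, conditions on coordinates, stand in for the random time
  window up to a null set. Monotone convergence turns the extended-real expectation into a series of
  probabilities, whose convergence includes finiteness.\<close>

lemma mean_visits_eq:
  assumes init: "prob_vector V init"
    and ae: "AE \<omega> in chain V p init. \<forall>l. (s \<omega> \<le> enat l \<and> enat l \<le> t \<omega> \<and> \<omega> l = x) = Q l \<omega>"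
    and obs: "\<And>l. observable (\<lambda>\<omega>. of_bool (Q l \<omega>))"
    and sums: "(\<lambda>l. \<integral>\<omega>. of_bool (Q l \<omega>) \<partial>chain V p init) sums r"
  shows "mean_visits (chain V p init) s t x = ereal r"
proof -
  let ?P = "chain V p init"
  have nn: "0 \<le> (\<integral>\<omega>. of_bool (Q l \<omega>) \<partial>?P :: real)" for l
    by (intro integral_nonneg_AE) simp
  have "(\<integral>\<^sup>+\<omega>. visits \<omega> (s \<omega>) (t \<omega>) x \<partial>?P) = (\<integral>\<^sup>+\<omega>. (\<Sum>l. ennreal (of_bool (Q l \<omega>))) \<partial>?P)"
    by (rule nn_integral_cong_AE, use ae in eventually_elim)
      (auto simp: visits_def of_bool_def intro!: suminf_cong)
  also have "\<dots> = (\<Sum>l. \<integral>\<^sup>+\<omega>. ennreal (of_bool (Q l \<omega>)) \<partial>?P)"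
    using integrable_observable[OF init obs] by (intro nn_integral_suminf) auto
  also have "\<dots> = (\<Sum>l. ennreal (\<integral>\<omega>. of_bool (Q l \<omega>) \<partial>?P))"
    using integrable_observable[OF init obs] by (intro suminf_cong nn_integral_eq_integral) auto
  also have "\<dots> = ennreal r"
    using sums nn by (subst suminf_ennreal2) (auto simp: sums_iff)
  finally have "mean_visits ?P s t x = enn2ereal (ennreal r)"
    by (simp only: mean_visits_def)
  also have "\<dots> = ereal r"
    using sums nn by (intro enn2ereal_ennreal) (auto simp: sums_iff suminf_nonneg)
  finally show ?thesis .
qed

end

section \<open>The committor and its complement\<close>

context reactive_chain
begin

abbreviation "q \<equiv> committor V p A B"

text \<open>The comparison of hitting times is spelled out on coordinates, which makes measurability
  immediate. Time 0 is included.\<close>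

definition "first_A \<omega> \<longleftrightarrow> (\<exists>l. \<omega> l \<in> A \<and> (\<forall>i\<le>l. \<omega> i \<notin> B))" for \<omega> :: "nat \<Rightarrow> 'a"
definition "first_B \<omega> \<longleftrightarrow> (\<exists>l. \<omega> l \<in> B \<and> (\<forall>i\<le>l. \<omega> i \<notin> A))" for \<omega> :: "nat \<Rightarrow> 'a"

lemma observable_first_A: "observable (\<lambda>\<omega>. of_bool (first_A \<omega>))"
  and observable_first_B: "observable (\<lambda>\<omega>. of_bool (first_B \<omega>))"
  unfolding first_A_def first_B_def by (rule observable_of_bool; measurable)+

lemma committor_eq: "x \<in> V \<Longrightarrow> q x = (\<integral>\<omega>. of_bool (first_B \<omega>) \<partial>chain_from x)"
proof -
  assume x: "x \<in> V"
  let ?P = "chain_from x"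
  note i = prob_vector_indicator[OF x]
  let ?S = "{\<omega> \<in> space ?P. first_B \<omega>}"
  have S: "?S \<inter> space ?P = ?S" by auto
  have "q x = measure ?P ?S"
    by (simp add: committor_def Let_def hitting_time_less_iff first_B_def del: space_chain)
  also have "\<dots> = (\<integral>\<omega>. indicator ?S \<omega> \<partial>?P)"
    by (simp add: S del: space_chain)
  also have "\<dots> = (\<integral>\<omega>. of_bool (first_B \<omega>) \<partial>?P)"
    by (intro Bochner_Integration.integral_cong) (auto simp: indicator_def)
  finally show ?thesis .
qed

lemma first_B_case_nat: "x \<notin> A \<union> B \<Longrightarrow> first_B (case_nat x \<omega>) = first_B \<omega>"
  unfolding first_B_def
proof (intro iffI; elim exE conjE)
  fix l assume x: "x \<notin> A \<union> B" and l: "case_nat x \<omega> l \<in> B" "\<forall>i\<le>l. case_nat x \<omega> i \<notin> A"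
  then obtain j where j: "l = Suc j" by (cases l) auto
  have "\<omega> i \<notin> A" if "i \<le> j" for i
    using l(2)[rule_format, of "Suc i"] that j by simp
  then show "\<exists>l. \<omega> l \<in> B \<and> (\<forall>i\<le>l. \<omega> i \<notin> A)"
    using l(1) j by auto
next
  fix l assume "x \<notin> A \<union> B" "\<omega> l \<in> B" "\<forall>i\<le>l. \<omega> i \<notin> A"
  then show "\<exists>l. case_nat x \<omega> l \<in> B \<and> (\<forall>i\<le>l. case_nat x \<omega> i \<notin> A)"
    by (intro exI[of _ "Suc l"]) (auto split: nat.split)
qed

lemma measure_chain_from: "x \<in> V \<Longrightarrow> measure (chain_from x) (space (chain_from x)) = 1"
  by (intro prob_space.prob_space prob_space_chain_init prob_vector_indicator)

lemma q_step: "x \<in> V - (A \<union> B) \<Longrightarrow> q x = (\<Sum>z\<in>V. p z x * q z)"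
  using integral_first_step[OF _ observable_first_B, of x]
  by (simp add: first_B_case_nat committor_eq)

lemma q_A: "x \<in> A \<Longrightarrow> q x = 0"
proof -
  assume x: "x \<in> A"
  then have "\<not> first_B (case_nat x \<omega>)" for \<omega>
    by (auto simp: first_B_def intro!: exI[of _ 0])
  then show ?thesis
    using integral_first_step[OF _ observable_first_B, of x] x A_sub by (auto simp: committor_eq)
qed

lemma q_B: "x \<in> B \<Longrightarrow> q x = 1"
proof -
  assume x: "x \<in> B"
  then have xV: "x \<in> V" using B_sub by auto
  have "first_B (case_nat x \<omega>)" for \<omega>
    using x disjoint by (auto simp: first_B_def intro!: exI[of _ 0])
  then show ?thesis
    using integral_first_step[OF xV observable_first_B]
    by (simp add: committor_eq xV measure_chain_from sum_p del: space_chain cong: sum.cong)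
qed

text \<open>Both events are decided by the first state visited in A \<union> B.\<close>

lemma first_A_iff_not_first_B:
  assumes "\<exists>l. \<omega> l \<in> A \<union> B"
  shows "first_A \<omega> \<longleftrightarrow> \<not> first_B \<omega>"
proof -
  define l where "l = (LEAST l. \<omega> l \<in> A \<union> B)"
  have l: "\<omega> l \<in> A \<union> B" using LeastI_ex[OF assms] by (simp add: l_def)
  have before: "\<omega> i \<notin> A \<union> B" if "i < l" for i using not_less_Least that by (auto simp: l_def)
  have "first_A \<omega> \<longleftrightarrow> \<omega> l \<in> A"
  proof
    assume "first_A \<omega>"
    then obtain k where "\<omega> k \<in> A" "\<forall>i\<le>k. \<omega> i \<notin> B" by (auto simp: first_A_def)
    then show "\<omega> l \<in> A" using l before[of k] by (cases "k < l") auto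
  next
    assume "\<omega> l \<in> A"
    then show "first_A \<omega>"
      using before disjoint by (auto simp: first_A_def le_less intro!: exI[of _ l])
  qed
  moreover have "first_B \<omega> \<longleftrightarrow> \<omega> l \<in> B"
  proof
    assume "first_B \<omega>"
    then obtain k where "\<omega> k \<in> B" "\<forall>i\<le>k. \<omega> i \<notin> A" by (auto simp: first_B_def)
    then show "\<omega> l \<in> B" using l before[of k] by (cases "k < l") auto
  next
    assume "\<omega> l \<in> B"
    then show "first_B \<omega>"
      using before disjoint by (auto simp: first_B_def le_less intro!: exI[of _ l])
  qed
  ultimately show ?thesis using l disjoint by auto
qed

text \<open>The two events are complementary almost surely, because a generic path visits b and so
  reaches A \<union> B.\<close>

lemma expectation_first_A:
  assumes x: "x \<in> V"
  shows "(\<integral>\<omega>. of_bool (first_A \<omega>) \<partial>chain_from x) = 1 - q x"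
proof -
  note i = prob_vector_indicator[OF x]
  have ae: "AE \<omega> in chain_from x. of_bool (first_A \<omega>) = (1 - of_bool (first_B \<omega>) :: real)"
    using AE_generic[OF i]
  proof eventually_elim
    case (elim \<omega>)
    then have "\<exists>l. \<omega> l = b" using generic_infinitely_often[OF elim, of b] b B_sub by (auto dest: INFM_EX)
    then have "\<exists>l. \<omega> l \<in> A \<union> B" using b by auto
    then show ?case using first_A_iff_not_first_B by auto
  qed
  have "(\<integral>\<omega>. of_bool (first_A \<omega>) \<partial>chain_from x) = (\<integral>\<omega>. 1 - of_bool (first_B \<omega>) \<partial>chain_from x :: real)"
    by (rule integral_cong_AE[OF _ _ ae])
      (intro borel_measurable_integrable integrable_observable[OF i]
        observable_diff observable_const observable_first_A observable_first_B)+
  also have "\<dots> = 1 - q x"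
    using integrable_observable[OF i observable_first_B] integrable_observable[OF i observable_const[of 1]]
      measure_chain_from[OF x]
    by (subst Bochner_Integration.integral_diff) (auto simp: committor_eq x simp del: space_chain)
  finally show ?thesis .
qed

text \<open>The probability that a visit to x is not followed by another visit to A before B. The
  shift leaves out the starting time, so x itself may lie in A.\<close>

lemma expectation_not_first_A_later:
  assumes x: "x \<in> V"
  shows "(\<integral>\<omega>. of_bool (\<not> first_A (path_shift (Suc 0) \<omega>)) \<partial>chain_from x) = (\<Sum>z\<in>V. p z x * q z)"
proof -
  have eq: "of_bool (\<not> first_A \<omega>) = (1 - of_bool (first_A \<omega>) :: real)" for \<omega> by simp
  have obs: "observable (\<lambda>\<omega>. of_bool (\<not> first_A \<omega>))"
    unfolding eq by (intro observable_diff observable_const observable_first_A)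
  have "(\<integral>\<omega>. of_bool (\<not> first_A \<omega>) \<partial>chain_from z) = q z" if z: "z \<in> V" for z
  proof -
    note i = prob_vector_indicator[OF z]
    show ?thesis
      unfolding eq using integrable_observable[OF i observable_first_A]
        integrable_observable[OF i observable_const[of 1]] measure_chain_from[OF z] expectation_first_A[OF z]
      by (subst Bochner_Integration.integral_diff) (auto simp del: space_chain)
  qed
  moreover have "path_shift (Suc 0) (case_nat x \<omega>) = \<omega>" for \<omega>
    by (simp add: path_shift_def)
  ultimately show ?thesis
    using integral_first_step[OF x observable_compose[OF obs measurable_path_shift[of "Suc 0"]]]
    by (simp cong: sum.cong)
qed

section \<open>The chain started from \<mu> and killed in B\<close>

definition \<mu> :: "'a \<Rightarrow> real" where
  "\<mu> x = (if x \<in> A then (\<Sum>y\<in>V. m y * (1 - qm y) * p x y) / Z else 0)"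

lemma prob_vector_mu: "prob_vector V \<mu>"
proof -
  have "0 \<le> \<mu> x" if "x \<in> V" for x
    using that Z_pos unfolding \<mu>_def
    by (auto intro!: divide_nonneg_pos sum_nonneg mult_nonneg_nonneg[OF m1qm_nonneg p_nonneg])
  moreover have "(\<Sum>x\<in>V. \<mu> x) = (\<Sum>x\<in>A. \<mu> x)"
    using A_sub finite_V by (intro sum.mono_neutral_right) (auto simp: \<mu>_def)
  moreover have "(\<Sum>x\<in>A. \<mu> x) = 1"
    using Z_pos by (simp add: \<mu>_def sum_divide_distrib[symmetric])
  ultimately show ?thesis by (simp add: prob_vector_def)
qed

abbreviation "P\<^sub>\<mu> \<equiv> chain V p \<mu>"

lemma AE_start_A: "AE \<omega> in P\<^sub>\<mu>. \<omega> 0 \<in> A"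
proof -
  have "(\<integral>\<omega>. of_bool (\<omega> 0 \<notin> A) \<partial>P\<^sub>\<mu>) = (\<Sum>y\<in>V. \<mu> y * of_bool (y \<notin> A))"
    by (rule integral_start[OF prob_vector_mu, of "\<lambda>y. of_bool (y \<notin> A)"])
  also have "\<dots> = 0" by (intro sum.neutral) (auto simp: \<mu>_def)
  finally have "AE \<omega> in P\<^sub>\<mu>. of_bool (\<omega> 0 \<notin> A) = (0::real)"
    using integrable_observable[OF prob_vector_mu observable_coord[of "\<lambda>y. of_bool (y \<notin> A)" 0]]
    by (subst (asm) integral_nonneg_eq_0_iff_AE) auto
  then show ?thesis by eventually_elim (auto split: if_splits)
qed

definition avoids :: "nat \<Rightarrow> (nat \<Rightarrow> 'a) \<Rightarrow> bool" where
  "avoids l \<omega> \<longleftrightarrow> (\<forall>i\<le>l. \<omega> i \<notin> B)"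

lemma avoids_at: "\<omega> l \<notin> B \<Longrightarrow> avoids l \<omega> \<longleftrightarrow> (\<forall>i<l. \<omega> i \<notin> B)"
  by (auto simp: avoids_def le_less)

lemma observable_avoids: "observable (\<lambda>\<omega>. of_bool (avoids l \<omega>))"
  unfolding avoids_def by (rule observable_of_bool) measurable

lemma adapted_avoids: "adapted l (\<lambda>\<omega>. of_bool (avoids l \<omega>))"
  by (auto simp: adapted_def avoids_def)

text \<open>The distribution at time l of the chain killed on entering B.\<close>

definition killed :: "nat \<Rightarrow> 'a \<Rightarrow> real" where
  "killed l x = (\<integral>\<omega>. of_bool (avoids l \<omega>) * of_bool (\<omega> l = x) \<partial>P\<^sub>\<mu>)"

lemma killed_nonneg: "0 \<le> killed l x"
  unfolding killed_def by (intro integral_nonneg_AE) simp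

lemma killed_B: "x \<in> B \<Longrightarrow> killed l x = 0"
proof -
  assume "x \<in> B"
  then have "of_bool (avoids l \<omega>) * of_bool (\<omega> l = x) = (0::real)" for \<omega>
    by (auto simp: avoids_def)
  then show ?thesis by (simp only: killed_def) simp
qed

lemma expectation_start: "x \<in> V \<Longrightarrow> (\<integral>\<omega>. of_bool (\<omega> 0 = x) \<partial>P\<^sub>\<mu>) = \<mu> x"
  using integral_start[OF prob_vector_mu, of "\<lambda>y. of_bool (y = x)"] finite_V
  by (simp add: of_bool_def if_distrib[of "\<lambda>t. \<mu> _ * t"] cong: if_cong)

lemma killed_0: "x \<in> V - B \<Longrightarrow> killed 0 x = \<mu> x"
proof -
  assume x: "x \<in> V - B"
  then have "of_bool (avoids 0 \<omega>) * of_bool (\<omega> 0 = x) = (of_bool (\<omega> 0 = x) :: real)" for \<omega>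
    by (auto simp: avoids_def)
  then show ?thesis using x expectation_start by (simp only: killed_def) simp
qed

text \<open>Survival is required only up to l, so x may lie in B. This yields both the recursion off
  B and the distribution of the hitting point in B.\<close>

lemma killed_step:
  assumes x: "x \<in> V"
  shows "(\<integral>\<omega>. of_bool (avoids l \<omega>) * of_bool (\<omega> (Suc l) = x) \<partial>P\<^sub>\<mu>) = (\<Sum>y\<in>V. p x y * killed l y)"
proof -
  let ?H = "\<lambda>\<omega>. of_bool (avoids l \<omega>) :: real"
  have pick: "(\<Sum>y\<in>V. p y z * of_bool (y = x)) = p x z" for z
    using x finite_V by (simp add: of_bool_def if_distrib[of "\<lambda>t. p _ z * t"] cong: if_cong)
  have i1: "integrable P\<^sub>\<mu> (\<lambda>\<omega>. ?H \<omega> * of_bool (\<omega> (Suc l) = x))"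
    by (intro integrable_observable[OF prob_vector_mu] observable_mult observable_avoids
        observable_coord[of "\<lambda>y. of_bool (y = x)"])
  have i2: "integrable P\<^sub>\<mu> (\<lambda>\<omega>. ?H \<omega> * p x (\<omega> l))"
    by (intro integrable_observable[OF prob_vector_mu] observable_mult observable_avoids
        observable_coord[of "p x"])
  have i3: "integrable P\<^sub>\<mu> (\<lambda>\<omega>. ?H \<omega> * of_bool (\<omega> l = y))" for y
    by (intro integrable_observable[OF prob_vector_mu] observable_mult observable_avoids
        observable_coord[of "\<lambda>z. of_bool (z = y)"])
  have "(\<integral>\<omega>. ?H \<omega> * of_bool (\<omega> (Suc l) = x) \<partial>P\<^sub>\<mu>) = (\<integral>\<omega>. ?H \<omega> * p x (\<omega> l) \<partial>P\<^sub>\<mu>)"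
    using martingale_increment[OF prob_vector_mu observable_avoids adapted_avoids,
        of l "\<lambda>y. of_bool (y = x)"] i1 i2
    unfolding pick right_diff_distrib by simp
  also have "\<dots> = (\<integral>\<omega>. (\<Sum>y\<in>V. p x y * (?H \<omega> * of_bool (\<omega> l = y))) \<partial>P\<^sub>\<mu>)"
  proof (rule Bochner_Integration.integral_cong[OF refl])
    fix \<omega> assume "\<omega> \<in> space P\<^sub>\<mu>"
    then have "\<omega> l \<in> V" using prob_vector_mu by simp
    then show "?H \<omega> * p x (\<omega> l) = (\<Sum>y\<in>V. p x y * (?H \<omega> * of_bool (\<omega> l = y)))"
      using finite_V by (subst sum.remove[of _ "\<omega> l"]) (auto intro!: sum.neutral)
  qed
  also have "\<dots> = (\<Sum>y\<in>V. p x y * killed l y)"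
    using i3 by (subst Bochner_Integration.integral_sum) (auto simp: killed_def simp del: of_bool_conj)
  finally show ?thesis .
qed

lemma killed_Suc:
  assumes x: "x \<in> V - B"
  shows "killed (Suc l) x = (\<Sum>y\<in>V. p x y * killed l y)"
proof -
  have "of_bool (avoids (Suc l) \<omega>) * of_bool (\<omega> (Suc l) = x) =
      (of_bool (avoids l \<omega>) * of_bool (\<omega> (Suc l) = x) :: real)" for \<omega>
    using x by (auto simp: avoids_def le_Suc_eq)
  then show ?thesis using killed_step[of x l] x by (simp only: killed_def) simp
qed

definition mean_time :: "'a \<Rightarrow> real" where
  "mean_time x = m x * qm x / Z"

text \<open>On A, the invariant inflow \<open>m x\<close> splits into the inflow of
  \<open>m (1 - qm)\<close>, which is \<open>Z * \<mu> x\<close>, and that of \<open>m qm\<close>.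
  On the rest of V - B there is no source and \<open>qm_step\<close> applies.\<close>

lemma mean_time_step: "x \<in> V - B \<Longrightarrow> mean_time x = \<mu> x + (\<Sum>y\<in>V. p x y * mean_time y)"
proof -
  assume x: "x \<in> V - B"
  have eq: "(\<Sum>y\<in>V. p x y * mean_time y) = (\<Sum>y\<in>V. p x y * (m y * qm y)) / Z"
    by (simp add: mean_time_def sum_divide_distrib)
  show ?thesis
  proof (cases "x \<in> A")
    case True
    then have "m x = (\<Sum>y\<in>V. p x y * m y)" using m_invariant[of x] A_sub by auto
    also have "\<dots> = (\<Sum>y\<in>V. m y * (1 - qm y) * p x y) + (\<Sum>y\<in>V. p x y * (m y * qm y))"
      by (simp add: sum.distrib[symmetric] algebra_simps)
    finally show ?thesis
      unfolding eq using True qm_A[OF True] by (simp add: \<mu>_def mean_time_def add_divide_distrib)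
  next
    case False
    then show ?thesis
      unfolding eq using x qm_step[of x] by (simp add: \<mu>_def mean_time_def)
  qed
qed

text \<open>The partial sums of \<open>killed\<close> stay below \<open>mean_time\<close> because both are obtained by iterating
  the same monotone affine map.\<close>

lemma killed_sums:
  assumes x: "x \<in> V"
  shows "(\<lambda>l. killed l x) sums mean_time x"
proof -
  have mt: "0 \<le> mean_time z" if "z \<in> V" for z
    using mqm_nonneg[OF that] Z_pos by (simp add: mean_time_def)
  have rec: "(\<Sum>l<Suc n. killed l z) = \<mu> z + (\<Sum>y\<in>V. p z y * (\<Sum>l<n. killed l y))"
    if "z \<in> V - B" for z n
    unfolding sum.lessThan_Suc_shift sum_distrib_left
    using that by (subst sum.swap) (simp add: killed_0 killed_Suc)
  have le: "(\<Sum>l<n. killed l z) \<le> mean_time z" if "z \<in> V" for z n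
    using that
  proof (induction n arbitrary: z)
    case (Suc n)
    show ?case
    proof (cases "z \<in> B")
      case True
      then show ?thesis using mt[OF Suc.prems] by (simp add: killed_B)
    next
      case False
      then have z: "z \<in> V - B" using Suc.prems by simp
      show ?thesis
        unfolding rec[OF z] mean_time_step[OF z] using Suc z
        by (intro add_mono sum_mono mult_left_mono p_nonneg) auto
    qed
  qed (simp add: mt)
  have summable: "summable (\<lambda>l. killed l z)" if "z \<in> V" for z
  proof (rule bounded_imp_summable[where B="mean_time z"])
    show "(\<Sum>l\<le>n. killed l z) \<le> mean_time z" for n
      unfolding lessThan_Suc_atMost[symmetric] by (rule le[OF that])
  qed (rule killed_nonneg)
  define s where "s z = (\<Sum>l. killed l z)" for z
  have lim: "(\<lambda>n. \<Sum>l<n. killed l z) \<longlonglongrightarrow> s z" if "z \<in> V" for z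
    unfolding s_def using summable[OF that] by (rule summable_LIMSEQ)
  have step: "s z = \<mu> z + (\<Sum>y\<in>V. p z y * s y)" if z: "z \<in> V - B" for z
  proof (rule LIMSEQ_unique)
    show "(\<lambda>n. \<Sum>l<Suc n. killed l z) \<longlonglongrightarrow> s z"
      using lim[of z] z by (intro LIMSEQ_Suc) auto
    show "(\<lambda>n. \<Sum>l<Suc n. killed l z) \<longlonglongrightarrow> \<mu> z + (\<Sum>y\<in>V. p z y * s y)"
      unfolding rec[OF z] by (intro tendsto_intros lim)
  qed
  have "mean_time x - s x = 0"
  proof (rule dirichlet_zero[OF B_sub _ _ _ x, where u="\<lambda>z. mean_time z - s z"])
    show "B \<noteq> {}" using b by auto
    show "mean_time z - s z = 0" if "z \<in> B" for z
      using that by (simp add: mean_time_def qm_B s_def killed_B)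
    show "mean_time z - s z = (\<Sum>y\<in>V. p z y * (mean_time y - s y))" if "z \<in> V - B" for z
      using step[OF that] mean_time_step[OF that] by (simp add: right_diff_distrib sum_subtractf)
  qed
  then show ?thesis using summable[OF x] by (simp add: s_def sums_iff)
qed

text \<open>Every visit to x before B restarts the chain at x, so a functional of the future
  contributes the same factor at each l.\<close>

lemma killed_event_sums:
  assumes x: "x \<in> V" and f: "observable f"
  shows "(\<lambda>l. \<integral>\<omega>. of_bool (avoids l \<omega>) * of_bool (\<omega> l = x) * f (path_shift l \<omega>) \<partial>P\<^sub>\<mu>)
    sums (mean_time x * (\<integral>\<omega>. f \<omega> \<partial>chain_from x))"
  unfolding markov[OF prob_vector_mu x observable_avoids adapted_avoids f] killed_def[symmetric]
  by (intro sums_mult2 killed_sums x)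

lemma observable_visit:
  "observable (\<lambda>\<omega>. of_bool (avoids l \<omega>) * of_bool (\<omega> l = x))"
  by (intro observable_mult observable_avoids observable_coord[of "\<lambda>y. of_bool (y = x)"])

section \<open>The formulas for \<open>theta\<close>, \<open>theta_bar\<close> and
  \<open>theta_tilde\<close>\<close>

lemma theta_off_B:
  assumes x: "x \<in> V - B"
  shows "theta V p \<mu> A B x = ereal (m x * qm x / Z)"
  unfolding theta_def mean_time_def[symmetric]
proof (rule mean_visits_eq[OF prob_vector_mu, where Q="\<lambda>l \<omega>. avoids l \<omega> \<and> \<omega> l = x"])
  show "AE \<omega> in P\<^sub>\<mu>. \<forall>l. (0 \<le> enat l \<and> enat l \<le> hitting_time B \<omega> \<and> \<omega> l = x) = (avoids l \<omega> \<and> \<omega> l = x)"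
    using x by (intro AE_I2) (auto simp: le_hitting_time_iff avoids_at)
  show "observable (\<lambda>\<omega>. of_bool (avoids l \<omega> \<and> \<omega> l = x))" for l
    unfolding of_bool_conj by (rule observable_visit)
  show "(\<lambda>l. \<integral>\<omega>. of_bool (avoids l \<omega> \<and> \<omega> l = x) \<partial>P\<^sub>\<mu>) sums mean_time x"
    unfolding of_bool_conj killed_def[symmetric] using x by (intro killed_sums) auto
qed

text \<open>B is first hit at time \<open>Suc l\<close> by a step of the chain killed in B. Time 0
  contributes nothing because \<mu> is carried by A.\<close>

lemma first_visit_sums:
  assumes x: "x \<in> B"
  shows "(\<lambda>l. \<integral>\<omega>. of_bool ((\<forall>i<l. \<omega> i \<notin> B) \<and> \<omega> l = x) \<partial>P\<^sub>\<mu>) sums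
    ((\<Sum>y\<in>V. m y * qm y * p x y) / Z)"
proof -
  have xV: "x \<in> V" using x B_sub by auto
  let ?v = "\<lambda>l. (\<integral>\<omega>. of_bool ((\<forall>i<l. \<omega> i \<notin> B) \<and> \<omega> l = x) \<partial>P\<^sub>\<mu> :: real)"
  have "?v 0 = 0"
  proof -
    have "x \<notin> A" using x disjoint by auto
    then show ?thesis using expectation_start[OF xV] by (simp add: \<mu>_def)
  qed
  moreover have "?v (Suc l) = (\<Sum>y\<in>V. p x y * killed l y)" for l
    unfolding less_Suc_eq_le avoids_def[symmetric] of_bool_conj by (rule killed_step[OF xV])
  moreover have "(\<lambda>l. \<Sum>y\<in>V. p x y * killed l y) sums (\<Sum>y\<in>V. p x y * mean_time y)"
    by (intro sums_sum sums_mult killed_sums)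
  ultimately have "?v sums (\<Sum>y\<in>V. p x y * mean_time y)"
    using sums_Suc_iff[of ?v] by simp
  also have "(\<Sum>y\<in>V. p x y * mean_time y) = (\<Sum>y\<in>V. m y * qm y * p x y) / Z"
    by (simp add: mean_time_def sum_divide_distrib mult.commute)
  finally show ?thesis .
qed

lemma observable_first_visit: "observable (\<lambda>\<omega>. of_bool ((\<forall>i<l. \<omega> i \<notin> B) \<and> \<omega> l = x))"
  by (rule observable_of_bool) measurable

lemma theta_B:
  assumes x: "x \<in> B"
  shows "theta V p \<mu> A B x = ereal ((\<Sum>y\<in>V. m y * qm y * p x y) / Z)"
  unfolding theta_def
  by (rule mean_visits_eq[OF prob_vector_mu _ observable_first_visit first_visit_sums[OF x]])
    (simp add: le_hitting_time_iff)

text \<open>On B the lower limit is no restriction: a time at which the path is in B bounds the last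
  exit. The event is therefore the same as for \<open>theta\<close>.\<close>

lemma theta_tilde_B:
  assumes x: "x \<in> B"
  shows "theta_tilde V p \<mu> A B x = ereal ((\<Sum>y\<in>V. m y * qm y * p x y) / Z)"
  unfolding theta_tilde_def
  by (rule mean_visits_eq[OF prob_vector_mu _ observable_first_visit first_visit_sums[OF x]],
      rule AE_I2)
    (use x in \<open>auto simp: le_hitting_time_iff last_exit_le_iff intro: less_imp_le\<close>)

text \<open>A time l does not exceed the last exit exactly if B is avoided up to l and, from l on, A
  comes before B. Given a visit to x, the second condition has probability
  \<open>1 - q x\<close>.\<close>

lemma theta_bar_eq:
  assumes x: "x \<in> V"
  shows "theta_bar V p \<mu> A B x = ereal (m x * qm x / Z * (1 - q x))"
  unfolding theta_bar_def mean_time_def[symmetric]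
proof (rule mean_visits_eq[OF prob_vector_mu,
      where Q="\<lambda>l \<omega>. (avoids l \<omega> \<and> \<omega> l = x) \<and> first_A (path_shift l \<omega>)"])
  show "AE \<omega> in P\<^sub>\<mu>. \<forall>l. (0 \<le> enat l \<and> enat l \<le> last_exit A B \<omega> \<and> \<omega> l = x) =
      ((avoids l \<omega> \<and> \<omega> l = x) \<and> first_A (path_shift l \<omega>))"
    using AE_start_A
  proof eventually_elim
    case (elim \<omega>)
    then have "\<omega> 0 \<notin> B" using disjoint by auto
    have "(\<exists>k\<ge>l. \<omega> k \<in> A \<and> (\<forall>i\<le>k. \<omega> i \<notin> B)) \<longleftrightarrow> avoids l \<omega> \<and> first_A (path_shift l \<omega>)" for l
    proof
      assume "\<exists>k\<ge>l. \<omega> k \<in> A \<and> (\<forall>i\<le>k. \<omega> i \<notin> B)"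
      then obtain k where "k \<ge> l" "\<omega> k \<in> A" "\<forall>i\<le>k. \<omega> i \<notin> B" by blast
      then show "avoids l \<omega> \<and> first_A (path_shift l \<omega>)"
        by (auto simp: avoids_def first_A_def path_shift_def intro!: exI[of _ "k - l"])
    next
      assume *: "avoids l \<omega> \<and> first_A (path_shift l \<omega>)"
      then obtain j where j: "\<omega> (l + j) \<in> A" "\<And>i. i \<le> j \<Longrightarrow> \<omega> (l + i) \<notin> B"
        by (auto simp: first_A_def path_shift_def)
      have "\<omega> i \<notin> B" if "i \<le> l + j" for i
        using * j(2)[of "i - l"] that by (cases "i \<le> l") (auto simp: avoids_def)
      then show "\<exists>k\<ge>l. \<omega> k \<in> A \<and> (\<forall>i\<le>k. \<omega> i \<notin> B)"
        using j(1) by (intro exI[of _ "l + j"]) auto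
    qed
    then show ?case
      using le_last_exit_iff[of \<omega> A B, OF elim \<open>\<omega> 0 \<notin> B\<close>] by auto
  qed
  show "observable (\<lambda>\<omega>. of_bool ((avoids l \<omega> \<and> \<omega> l = x) \<and> first_A (path_shift l \<omega>)))" for l
    unfolding of_bool_conj[of "_ \<and> _"] of_bool_conj
    by (intro observable_mult[OF observable_visit] observable_compose[OF observable_first_A] measurable_path_shift)
  show "(\<lambda>l. \<integral>\<omega>. of_bool ((avoids l \<omega> \<and> \<omega> l = x) \<and> first_A (path_shift l \<omega>)) \<partial>P\<^sub>\<mu>) sums
      (mean_time x * (1 - q x))"
    using killed_event_sums[OF x observable_first_A]
    by (simp only: of_bool_conj expectation_first_A[OF x])
qed

text \<open>Time l is at or after the last exit if A is not visited again before B. The second shift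
  leaves out time l itself, so the last exit is counted here as well as in
  \<open>theta_bar\<close>.\<close>

lemma theta_tilde_off_B:
  assumes x: "x \<in> V - B"
  shows "theta_tilde V p \<mu> A B x = ereal (m x * qm x / Z * (\<Sum>z\<in>V. p z x * q z))"
  unfolding theta_tilde_def mean_time_def[symmetric]
proof (rule mean_visits_eq[OF prob_vector_mu,
      where Q="\<lambda>l \<omega>. (avoids l \<omega> \<and> \<omega> l = x) \<and> \<not> first_A (path_shift (Suc 0) (path_shift l \<omega>))"])
  have "(last_exit A B \<omega> \<le> enat l \<and> enat l \<le> hitting_time B \<omega> \<and> \<omega> l = x) =
      ((avoids l \<omega> \<and> \<omega> l = x) \<and> \<not> first_A (path_shift (Suc 0) (path_shift l \<omega>)))" for \<omega> l
  proof (cases "avoids l \<omega> \<and> \<omega> l = x")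
    case True
    have "(\<forall>k>l. \<omega> k \<in> A \<longrightarrow> (\<exists>i\<le>k. \<omega> i \<in> B)) \<longleftrightarrow> \<not> first_A (path_shift (Suc 0) (path_shift l \<omega>))"
    proof
      assume *: "\<forall>k>l. \<omega> k \<in> A \<longrightarrow> (\<exists>i\<le>k. \<omega> i \<in> B)"
      show "\<not> first_A (path_shift (Suc 0) (path_shift l \<omega>))"
      proof
        assume "first_A (path_shift (Suc 0) (path_shift l \<omega>))"
        then obtain j where j: "\<omega> (l + Suc j) \<in> A" "\<And>i. i \<le> j \<Longrightarrow> \<omega> (l + Suc i) \<notin> B"
          by (auto simp: first_A_def path_shift_def)
        then obtain i where i: "i \<le> l + Suc j" "\<omega> i \<in> B"
          using *[rule_format, of "l + Suc j"] by auto
        then have "\<not> i \<le> l" using True by (auto simp: avoids_def)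
        then have "i - Suc l \<le> j" "l + Suc (i - Suc l) = i" using i(1) by simp_all
        then show False using j(2)[of "i - Suc l"] i(2) by simp
      qed
    next
      assume *: "\<not> first_A (path_shift (Suc 0) (path_shift l \<omega>))"
      show "\<forall>k>l. \<omega> k \<in> A \<longrightarrow> (\<exists>i\<le>k. \<omega> i \<in> B)"
      proof (intro allI impI)
        fix k assume k: "k > l" "\<omega> k \<in> A"
        then have "\<omega> (l + Suc (k - Suc l)) \<in> A" by simp
        then obtain i where "i \<le> k - Suc l" "\<omega> (l + Suc i) \<in> B"
          using * unfolding first_A_def path_shift_def by auto
        then show "\<exists>i\<le>k. \<omega> i \<in> B" using k by (intro exI[of _ "l + Suc i"]) auto
      qed
    qed
    then show ?thesis
      using True by (auto simp: last_exit_le_iff le_hitting_time_iff avoids_def)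
  next
    case False
    then show ?thesis using x by (auto simp: le_hitting_time_iff avoids_at)
  qed
  then show "AE \<omega> in P\<^sub>\<mu>. \<forall>l. (last_exit A B \<omega> \<le> enat l \<and> enat l \<le> hitting_time B \<omega> \<and> \<omega> l = x) =
      ((avoids l \<omega> \<and> \<omega> l = x) \<and> \<not> first_A (path_shift (Suc 0) (path_shift l \<omega>)))"
    by (intro AE_I2 allI)
  have eq: "of_bool (\<not> first_A \<omega>) = (1 - of_bool (first_A \<omega>) :: real)" for \<omega> by simp
  have obs: "observable (\<lambda>\<omega>. of_bool (\<not> first_A (path_shift (Suc 0) \<omega>)))"
    unfolding eq by (intro observable_diff observable_const observable_compose[OF observable_first_A] measurable_path_shift)
  show "observable (\<lambda>\<omega>. of_bool ((avoids l \<omega> \<and> \<omega> l = x) \<and> \<not> first_A (path_shift (Suc 0) (path_shift l \<omega>))))" for l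
    unfolding of_bool_conj[of "_ \<and> _"] of_bool_conj
    by (intro observable_mult[OF observable_visit] observable_compose[OF obs] measurable_path_shift)
  have xV: "x \<in> V" using x by simp
  show "(\<lambda>l. \<integral>\<omega>. of_bool ((avoids l \<omega> \<and> \<omega> l = x) \<and> \<not> first_A (path_shift (Suc 0) (path_shift l \<omega>))) \<partial>P\<^sub>\<mu>) sums
      (mean_time x * (\<Sum>z\<in>V. p z x * q z))"
    using killed_event_sums[OF xV obs]
    by (simp only: of_bool_conj expectation_not_first_A_later[OF xV])
qed

end

theorem proposition9:
  fixes n :: nat and V A B :: "nat set"
    and p :: "nat \<Rightarrow> nat \<Rightarrow> real" and m q qm :: "nat \<Rightarrow> real" and Z :: real
  assumes "n > 1" and "V = {1..n}"
    and "A \<subseteq> V" and "B \<subseteq> V" and "A \<inter> B = {}"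
    and "A \<noteq> {}" and "B \<noteq> {}" and "V - (A \<union> B) \<noteq> {}"
    and "transition_matrix V p" and "irreducible_chain V p" and "aperiodic_chain V p"
    and "invariant_measure V p m"
    and "q = committor V p A B"
    and "backward_committor V p m A B qm"
    and "Z = (\<Sum>x\<in>A. \<Sum>y\<in>V. m y * (1 - qm y) * p x y)"
  shows "Z = (\<Sum>x\<in>B. \<Sum>y\<in>V. m y * qm y * p x y) \<and>
    (\<exists>\<mu> \<mu>r.
      nonreactive_initial_distribution V p m A B \<mu> \<and>
      reactive_initial_distribution V p m A B \<mu>r \<and>
      (\<forall>x\<in>A. \<mu> x = 1 / Z * (\<Sum>y\<in>V. m y * (1 - qm y) * p x y)) \<and>
      (\<forall>x\<in>V - B. theta V p \<mu> A B x = ereal (1 / Z * m x * qm x)) \<and>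
      (\<forall>x\<in>B. theta V p \<mu> A B x = ereal (1 / Z * (\<Sum>y\<in>V. m y * qm y * p x y))) \<and>
      (\<forall>x\<in>A. \<mu>r x = 1 / Z * m x * (\<Sum>z\<in>V. p z x * q z)) \<and>
      (\<forall>x\<in>V. theta_bar V p \<mu> A B x = ereal (1 / Z * m x * qm x * (1 - q x))) \<and>
      (\<forall>x\<in>V - B. theta_tilde V p \<mu> A B x =
         ereal (1 / Z * m x * qm x * q x +
                1 / Z * m x * (\<Sum>z\<in>V. p z x * q z) * indicator A x)) \<and>
      (\<forall>x\<in>B. theta_tilde V p \<mu> A B x = ereal (1 / Z * (\<Sum>y\<in>V. m y * qm y * p x y))))"
proof -
  obtain b where b: "b \<in> B" using \<open>B \<noteq> {}\<close> by blast
  interpret R: reactive_chain V p m A B b qm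
    using assms b by unfold_locales simp_all
  let ?\<mu> = "R.\<mu>"
  \<comment> \<open>The frequencies are required to converge at every x, and off A they
    vanish.\<close>
  let ?\<mu>r = "\<lambda>x. if x \<in> A then m x * (\<Sum>z\<in>V. p z x * q z) / Z else 0"
  have Z: "Z = R.Z" by fact
  have "nonreactive_initial_distribution V p m A B ?\<mu>"
    using R.nonreactive_initial_distribution unfolding R.\<mu>_def .
  moreover have "reactive_initial_distribution V p m A B ?\<mu>r"
    unfolding \<open>q = _\<close> Z by (intro R.reactive_initial_distribution R.q_step R.q_A R.q_B)
  moreover have "\<forall>x\<in>A. ?\<mu> x = 1 / Z * (\<Sum>y\<in>V. m y * (1 - qm y) * p x y)"
    by (simp add: R.\<mu>_def Z)
  moreover have "\<forall>x\<in>V - B. theta V p ?\<mu> A B x = ereal (1 / Z * m x * qm x)"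
    using R.theta_off_B by (simp add: Z)
  moreover have "\<forall>x\<in>B. theta V p ?\<mu> A B x = ereal (1 / Z * (\<Sum>y\<in>V. m y * qm y * p x y))"
    using R.theta_B by (simp add: Z)
  moreover have "\<forall>x\<in>A. ?\<mu>r x = 1 / Z * m x * (\<Sum>z\<in>V. p z x * q z)"
    by simp
  moreover have "\<forall>x\<in>V. theta_bar V p ?\<mu> A B x = ereal (1 / Z * m x * qm x * (1 - q x))"
    using R.theta_bar_eq by (simp add: Z \<open>q = _\<close>)
  moreover have "\<forall>x\<in>V - B. theta_tilde V p ?\<mu> A B x =
      ereal (1 / Z * m x * qm x * q x + 1 / Z * m x * (\<Sum>z\<in>V. p z x * q z) * indicator A x)"
  proof
    fix x assume x: "x \<in> V - B"
    show "theta_tilde V p ?\<mu> A B x =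
      ereal (1 / Z * m x * qm x * q x + 1 / Z * m x * (\<Sum>z\<in>V. p z x * q z) * indicator A x)"
    \<comment> \<open>On A the first summand vanishes, since q = 0, and \<open>qm\<close> is 1 in
      the product formula. Off A the one-step mean of q is q itself.\<close>
    proof (cases "x \<in> A")
      case True
      then show ?thesis
        using R.theta_tilde_off_B[OF x] R.q_A[OF True] R.qm_A[OF True] by (simp add: Z \<open>q = _\<close>)
    next
      case False
      then show ?thesis
        using R.theta_tilde_off_B[OF x] R.q_step[of x] x by (simp add: Z \<open>q = _\<close>)
    qed
  qed
  moreover have "\<forall>x\<in>B. theta_tilde V p ?\<mu> A B x = ereal (1 / Z * (\<Sum>y\<in>V. m y * qm y * p x y))"
    using R.theta_tilde_B by (simp add: Z)
  ultimately show ?thesis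
    using R.Z_eq unfolding Z[symmetric] by blast
qed

end
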